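(* Let $r$ be an even positive integer and $a$ an odd integer. For $k\ge1$ let $F_k$ be the $k\times k$ matrix with $2$ on the diagonal, $1$ on the first super- and subdiagonal and $0$ elsewhere, and $e_1$ the first standard basis column vector of appropriate size. (1) If $a\equiv1\pmod8$, the discriminant module of the positive definite even lattice with $1\times1$ Gram matrix $(2^r)$ is isometrically isomorphic to $\underline{A}_{2^r}^a$. (2) If $a\equiv3\pmod8$, let $v$ be an integer with $2^{r-1}v^2\equiv-1\pmod3$ and $x=\frac{2^{r-1}v^2+1}{3}$; then the discriminant module of the positive definite even lattice with Gram matrix $\begin{pmatrix}3\cdot2^r & 2^rv & 0\\ 2^rv & 2x & 1\\ 0&1&2\end{pmatrix}$ is isometrically isomorphic to $\underline{A}_{2^r}^a$. (3) If $a\equiv5\pmod8$, let $v$ be an integer with $2^{r-1}v^2\equiv-2\pmod5$ and $x=\frac{2^{r-1}v^2+2}{5}$; then the discriminant module of the positive definite even lattice with $5\times5$ Gram matrix $\begin{pmatrix}5\cdot2^r & 2^rv & 0\\ 2^rv & 2x & e_1^{\mathrm T}\\ 0&e_1&F_3\end{pmatrix}$ is isometrically isomorphic to $\underline{A}_{2^r}^a$. (4) If $a\equiv7\pmod8$, let $v$ be an integer with $2^{r-1}v^2\equiv-3\pmod7$ and $x=\frac{2^{r-1}v^2+3}{7}$; then the discriminant module of the positive definite even lattice with $7\times7$ Gram matrix $\begin{pmatrix}7\cdot2^r & 2^rv & 0\\ 2^rv & 2x & e_1^{\mathrm T}\\ 0&e_1&F_5\end{pmatrix}$ is isometrically isomorphic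 to $\underline{A}_{2^r}^a$. Moreover, in each case the rank of the given lattice is the least among all positive definite even lattices whose discriminant module is isometrically isomorphic to $\underline{A}_{2^r}^a$.
   Context: A lattice $(L,B)$ is a free $\mathbb{Z}$-module of finite rank with symmetric bilinear $B\colon L\times L\to\mathbb{R}$ whose Gram matrix has nonzero determinant; even means $B(x,y)\in\mathbb{Z}$, $B(x,x)\in2\mathbb{Z}$; positive definite means $B(x,x)>0$ for $x\ne0$. The lattice with Gram matrix $G$ is $\mathbb{Z}^n$ with $B(x,y)=x^{\mathrm T}Gy$. Dual lattice $L^\sharp=\{v\in\mathbb{R}\otimes L: B(v,w)\in\mathbb{Z}\ \forall w\in L\}$; discriminant module $D_L=(L^\sharp/L,\ v+L\mapsto\frac12B(v,v)+\mathbb{Z})$. Finite quadratic modules: finite abelian groups with $Q\colon M\to\mathbb{Q}/\mathbb{Z}$, $Q(nx)=n^2Q(x)$, $Q(x+y)-Q(x)-Q(y)$ bilinear nondegenerate; isometric isomorphism = group isomorphism preserving $Q$. $\underline{A}_{2^r}^a=(\mathbb{Z}/2^r\mathbb{Z},\ x+2^r\mathbb{Z}\mapsto\frac{a}{2^{r+1}}x^2+\mathbb{Z})$. *)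

theory Defs
  imports
    Complex_Main
    "HOL-Library.Function_Algebras"
    "HOL-Library.Set_Algebras"
    "HOL-Algebra.Coset"
    "HOL-Algebra.Elementary_Groups"
    "HOL-Number_Theory.Cong"
    "Jordan_Normal_Form.Determinant"
begin

text \<open>
  The pointwise real vector space structure on functions. It makes \<^typ>\<open>nat \<Rightarrow> real\<close> a single
  type containing every \<open>\<real>\<^sup>n\<close>, as the functions that vanish from \<open>n\<close> on.
\<close>

instantiation "fun" :: (type, real_vector) real_vector
begin

definition scaleR_fun :: "real \<Rightarrow> ('a \<Rightarrow> 'b) \<Rightarrow> 'a \<Rightarrow> 'b" where
  "scaleR_fun c f = (\<lambda>i. c *\<^sub>R f i)"

instance
  by standard (auto simp: scaleR_fun_def fun_eq_iff scaleR_add_right scaleR_add_left)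

end

text \<open>
  A free \<open>\<int>\<close>-module \<open>L\<close> of finite rank is given inside a real vector space, with a \<open>\<int>\<close>-basis that
  is linearly independent over \<open>\<real>\<close>. Hence \<open>\<real> \<otimes> L\<close> is \<^term>\<open>span L\<close>, and the form on \<open>L\<close> is given
  together with its unique \<open>\<real>\<close>-bilinear extension to \<^term>\<open>span L\<close>; its values elsewhere are
  irrelevant.
\<close>

definition lattice_basis :: "'v::real_vector set \<Rightarrow> 'v list \<Rightarrow> bool" where
  "lattice_basis L bs \<longleftrightarrow> distinct bs \<and> independent (set bs) \<and>
     L = {\<Sum>i<length bs. real_of_int (c i) *\<^sub>R bs ! i | c. True}"

definition lattice_rank :: "'v::real_vector set \<Rightarrow> nat" where
  "lattice_rank L = (THE n. \<exists>bs. lattice_basis L bs \<and> length bs = n)"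

definition gram_matrix :: "('v \<Rightarrow> 'v \<Rightarrow> real) \<Rightarrow> 'v list \<Rightarrow> real mat" where
  "gram_matrix B bs = mat (length bs) (length bs) (\<lambda>(i, j). B (bs ! i) (bs ! j))"

definition sym_bilinear_on :: "'v::real_vector set \<Rightarrow> ('v \<Rightarrow> 'v \<Rightarrow> real) \<Rightarrow> bool" where
  "sym_bilinear_on V B \<longleftrightarrow>
     (\<forall>x\<in>V. \<forall>y\<in>V. B x y = B y x) \<and>
     (\<forall>x\<in>V. \<forall>y\<in>V. \<forall>z\<in>V. B (x + y) z = B x z + B y z) \<and>
     (\<forall>c. \<forall>x\<in>V. \<forall>y\<in>V. B (c *\<^sub>R x) y = c * B x y)"

definition is_lattice :: "'v::real_vector set \<Rightarrow> ('v \<Rightarrow> 'v \<Rightarrow> real) \<Rightarrow> bool" where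
  "is_lattice L B \<longleftrightarrow> sym_bilinear_on (span L) B \<and>
     (\<exists>bs. lattice_basis L bs \<and> det (gram_matrix B bs) \<noteq> 0)"

definition even_lattice :: "'v::real_vector set \<Rightarrow> ('v \<Rightarrow> 'v \<Rightarrow> real) \<Rightarrow> bool" where
  "even_lattice L B \<longleftrightarrow> is_lattice L B \<and>
     (\<forall>x\<in>L. \<forall>y\<in>L. B x y \<in> \<int>) \<and> (\<forall>x\<in>L. \<exists>k::int. B x x = 2 * real_of_int k)"

definition positive_definite :: "'v::real_vector set \<Rightarrow> ('v \<Rightarrow> 'v \<Rightarrow> real) \<Rightarrow> bool" where
  "positive_definite L B \<longleftrightarrow> (\<forall>x\<in>L. x \<noteq> 0 \<longrightarrow> B x x > 0)"

definition dual_lattice :: "'v::real_vector set \<Rightarrow> ('v \<Rightarrow> 'v \<Rightarrow> real) \<Rightarrow> 'v set" where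
  "dual_lattice L B = {v \<in> span L. \<forall>w\<in>L. B v w \<in> \<int>}"

text \<open>
  A quadratic module is a group together with a map into \<open>\<real>/\<int>\<close>, whose elements are the cosets
  \<open>q +o \<int>\<close>. The values that occur for even lattices lie in \<open>\<rat>/\<int>\<close>.
\<close>

type_synonym 'a quadratic_module = "'a monoid \<times> ('a \<Rightarrow> real set)"

definition isometrically_isomorphic ::
    "'a quadratic_module \<Rightarrow> 'b quadratic_module \<Rightarrow> bool" where
  "isometrically_isomorphic M N \<longleftrightarrow>
     (\<exists>h \<in> iso (fst M) (fst N). \<forall>x \<in> carrier (fst M). snd N (h x) = snd M x)"

text \<open>
  The union over the representatives of a class in \<open>L\<^sup>\<sharp>/L\<close> is a single coset of \<open>\<int>\<close> when \<open>L\<close> is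
  even, since the coset then does not depend on the representative.
\<close>

definition discriminant_module ::
    "'v::real_vector set \<Rightarrow> ('v \<Rightarrow> 'v \<Rightarrow> real) \<Rightarrow> 'v set quadratic_module" where
  "discriminant_module L B =
     (\<lparr>carrier = dual_lattice L B, monoid.mult = (+), one = 0\<rparr> Mod L,
      \<lambda>X. \<Union>v\<in>X. (B v v / 2) +o \<int>)"

definition A_module :: "nat \<Rightarrow> int \<Rightarrow> int quadratic_module" where
  "A_module r a =
     (integer_mod_group (2 ^ r), \<lambda>x. (real_of_int a / 2 ^ (r + 1) * (real_of_int x)\<^sup>2) +o \<int>)"

definition Z_lattice :: "nat \<Rightarrow> (nat \<Rightarrow> real) set" where
  "Z_lattice n = {x. (\<forall>i<n. x i \<in> \<int>) \<and> (\<forall>i\<ge>n. x i = 0)}"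

definition gram_form :: "real mat \<Rightarrow> (nat \<Rightarrow> real) \<Rightarrow> (nat \<Rightarrow> real) \<Rightarrow> real" where
  "gram_form G x y = vec (dim_row G) x \<bullet> (G *\<^sub>v vec (dim_col G) y)"

definition F_matrix :: "nat \<Rightarrow> real mat" where
  "F_matrix k = mat k k (\<lambda>(i, j). if i = j then 2 else if i = Suc j \<or> j = Suc i then 1 else 0)"

text \<open>The matrix with rows \<open>(p, q, 0)\<close>, \<open>(q, s, e\<^sub>1\<^sup>T)\<close>, \<open>(0, e\<^sub>1, F\<^sub>k)\<close>.\<close>

definition bordered_matrix :: "real \<Rightarrow> real \<Rightarrow> real \<Rightarrow> nat \<Rightarrow> real mat" where
  "bordered_matrix p q s k =
     four_block_mat
       (mat_of_rows_list 2 [[p, q], [q, s]]) (mat_of_rows k [0\<^sub>v k, unit_vec k 0])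
       (mat_of_cols k [0\<^sub>v k, unit_vec k 0]) (F_matrix k)"

definition realizes ::
    "'v::real_vector set \<Rightarrow> ('v \<Rightarrow> 'v \<Rightarrow> real) \<Rightarrow> 'a quadratic_module \<Rightarrow> bool" where
  "realizes L B M \<longleftrightarrow> even_lattice L B \<and> positive_definite L B \<and>
     isometrically_isomorphic (discriminant_module L B) M"

end

theory Submission
  imports Defs
begin

text \<open>
  Minimality of the rank. Let \<open>\<gamma>\<close> generate \<open>L\<^sup>\<sharp>/L \<cong> \<int>/2\<^sup>r\<close> and put \<open>u = 2\<^bsup>r/2\<^esup>\<gamma>\<close>. Since \<open>r\<close> is even,
  \<open>M = L + \<int>u\<close> is integral and self-dual, \<open>u\<close> is a characteristic vector of \<open>M\<close>
  (\<open>B(x,x) \<equiv> B(x,u)\<close> mod \<open>2\<close>), and \<open>B(u,u) \<equiv> a\<close> mod \<open>8\<close>. Hermite's inequality gives a positive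
  definite unimodular lattice of rank \<open>n \<le> 5\<close> a vector of norm \<open>1\<close>; splitting it off repeatedly
  shows \<open>B(u,u) \<equiv> n\<close> mod \<open>8\<close>. Rank \<open>6\<close> is excluded because \<open>B(u,u)\<close> odd forces \<open>n\<close> odd.

  Existence. The first row of each Gram matrix is divisible by \<open>2\<^sup>r\<close>, so \<open>e\<^sub>1/2\<^sup>r\<close> lies in the dual
  lattice; it generates the discriminant group and has norm \<open>b/2\<^sup>r\<close> with \<open>b \<in> {1, 3, 5, 7}\<close>. An odd
  multiple of it has norm congruent to \<open>a/2\<^sup>r\<close> mod \<open>2\<close>, because \<open>a \<equiv> b\<close> mod \<open>8\<close> makes \<open>a/b\<close> a square
  modulo every power of \<open>2\<close>.
\<close>

section \<open>Integral quadratic forms\<close>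

text \<open>That the norm of a characteristic vector is congruent to the rank modulo 8 holds for
  positive definite unimodular lattices of every rank (van der Blij), but is usually proved with
  Gauss sums or the classification of indefinite lattices. Only ranks below 7 have to be excluded
  here, and for these an elementary argument almost suffices. Hermite's inequality bounds the
  minimum of a unimodular lattice of rank n by (4/3)^((n-1)/2), which is 16/9 < 2 for n = 5 but
  exceeds 2 for n = 6. The parity argument fills this single gap.

  Evenness of r provides an integer m = 2^(r/2) with m^2 = 2^r. The lattice L + Zu contains L with
  index m, and this is the only index at which an overlattice of L can be self-dual. Since r is at
  least 2, m is even and 8 divides 2^(r+1), so the residue of a modulo 8 survives in the norm of
  u.\<close>

definition bform :: "int mat \<Rightarrow> int vec \<Rightarrow> int vec \<Rightarrow> int" where
  "bform G x y = x \<bullet> (G *\<^sub>v y)"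

text \<open>Integer test vectors are enough: a semidefinite form with integer coefficients has a
  rational kernel, so this agrees with definiteness over the reals.\<close>

definition posdef_mat :: "nat \<Rightarrow> int mat \<Rightarrow> bool" where
  "posdef_mat n G \<longleftrightarrow> G \<in> carrier_mat n n \<and> transpose_mat G = G \<and>
     (\<forall>x\<in>carrier_vec n. x \<noteq> 0\<^sub>v n \<longrightarrow> bform G x x > 0)"

text \<open>The Schur complement of the corner entry \<open>p\<close>, multiplied by
  \<open>p\<close>: its entries are the 2 x 2 minors through the corner, so no division occurs. For
  symmetric \<open>G\<close> with \<open>p = 1\<close> it is the Gram matrix of the orthogonal
  complement of the first basis vector.\<close>

definition schur_mat :: "int mat \<Rightarrow> int mat" where
  "schur_mat G = mat (dim_row G - 1) (dim_col G - 1)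
     (\<lambda>(i, j). G $$ (0, 0) * G $$ (Suc i, Suc j) - G $$ (Suc i, 0) * G $$ (0, Suc j))"

definition top_row :: "int mat \<Rightarrow> int vec" where
  "top_row G = vec (dim_col G - 1) (\<lambda>j. G $$ (0, Suc j))"

lemma mult_mat_vec_smult:
  assumes "(A :: int mat) \<in> carrier_mat m n" "v \<in> carrier_vec n"
  shows "A *\<^sub>v (k \<cdot>\<^sub>v v) = k \<cdot>\<^sub>v (A *\<^sub>v v)"
  using assms by (intro eq_vecI) auto

lemma bform_sum:
  assumes "G \<in> carrier_mat n n" "x \<in> carrier_vec n" "y \<in> carrier_vec n"
  shows "bform G x y = (\<Sum>i<n. \<Sum>j<n. x $ i * G $$ (i, j) * y $ j)"
proof -
  have "bform G x y = (\<Sum>i<n. x $ i * (\<Sum>j<n. G $$ (i, j) * y $ j))"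
    using assms by (auto simp: bform_def scalar_prod_def atLeast0LessThan intro!: sum.cong)
  thus ?thesis by (simp add: sum_distrib_left mult.assoc)
qed

lemma bform_unit_vec:
  assumes "G \<in> carrier_mat n n" "i < n" "j < n"
  shows "bform G (unit_vec n i) (unit_vec n j) = G $$ (i, j)"
  using assms by (auto simp: bform_def)

lemma bform_congruent:
  assumes "G \<in> carrier_mat n n" "P \<in> carrier_mat n n" "x \<in> carrier_vec n" "y \<in> carrier_vec n"
  shows "bform (transpose_mat P * G * P) x y = bform G (P *\<^sub>v x) (P *\<^sub>v y)"
proof -
  have "(transpose_mat P * G * P) *\<^sub>v y = transpose_mat P *\<^sub>v (G *\<^sub>v (P *\<^sub>v y))"
    using assms by (simp add: assoc_mult_mat_vec[of _ n n _ n])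
  moreover have "x \<bullet> (transpose_mat P *\<^sub>v w) = (P *\<^sub>v x) \<bullet> w" if "w \<in> carrier_vec n" for w
  proof -
    have "x \<bullet> (transpose_mat P *\<^sub>v w) = (transpose_mat P *\<^sub>v w) \<bullet> x"
      using assms that by (intro comm_scalar_prod[of _ n]) auto
    also have "\<dots> = w \<bullet> (P *\<^sub>v x)"
      using assms that transpose_vec_mult_scalar[of P n n x w] by simp
    also have "\<dots> = (P *\<^sub>v x) \<bullet> w"
      using assms that by (intro comm_scalar_prod[of _ n]) auto
    finally show ?thesis .
  qed
  ultimately show ?thesis using assms by (simp add: bform_def)
qed

text \<open>Completing the square in the first variable, scaled by the corner entry to stay integral.\<close>

lemma bform_vCons:
  assumes G: "G \<in> carrier_mat (Suc m) (Suc m)" "transpose_mat G = G"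
    and z: "z \<in> carrier_vec m" "z' \<in> carrier_vec m"
  shows "G $$ (0, 0) * bform G (vCons k z) (vCons k' z') =
    (G $$ (0, 0) * k + top_row G \<bullet> z) * (G $$ (0, 0) * k' + top_row G \<bullet> z') +
    bform (schur_mat G) z z'"
proof -
  define p where "p = G $$ (0, 0)"
  define g where "g i = G $$ (0, Suc i)" for i
  have sym: "G $$ (Suc i, 0) = g i" if "i < m" for i
    using G that unfolding g_def by (metis Suc_less_eq carrier_matD index_transpose_mat(1) zero_less_Suc)
  have q: "top_row G \<bullet> u = (\<Sum>i<m. g i * u $ i)" if "u \<in> carrier_vec m" for u
    using G that by (auto simp: top_row_def scalar_prod_def atLeast0LessThan g_def intro!: sum.cong)
  define H where "H = (\<Sum>i<m. \<Sum>j<m. z $ i * G $$ (Suc i, Suc j) * z' $ j)"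
  have S: "schur_mat G \<in> carrier_mat m m" using G by (simp add: schur_mat_def)
  have "bform (schur_mat G) z z' = (\<Sum>i<m. \<Sum>j<m. z $ i * (p * G $$ (Suc i, Suc j) - g i * g j) * z' $ j)"
    unfolding bform_sum[OF S z]
    using G by (intro sum.cong refl) (auto simp: schur_mat_def p_def sym g_def)
  also have "\<dots> = (\<Sum>i<m. \<Sum>j<m. p * (z $ i * G $$ (Suc i, Suc j) * z' $ j) - (g i * z $ i) * (g j * z' $ j))"
    by (intro sum.cong refl) (simp add: algebra_simps)
  also have "\<dots> = p * H - (\<Sum>i<m. g i * z $ i) * (\<Sum>i<m. g i * z' $ i)"
    by (simp only: H_def sum_subtractf sum_distrib_left[symmetric] sum_product)
  finally have 1: "bform (schur_mat G) z z' = p * H - (top_row G \<bullet> z) * (top_row G \<bullet> z')"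
    using q z by simp
  have "bform G (vCons k z) (vCons k' z') =
      k * p * k' + (\<Sum>j<m. k * g j * z' $ j) + (\<Sum>i<m. z $ i * g i * k' + (\<Sum>j<m. z $ i * G $$ (Suc i, Suc j) * z' $ j))"
    using z sym by (subst bform_sum[OF G(1)])
      (auto simp: sum.lessThan_Suc_shift p_def g_def simp del: sum.lessThan_Suc intro!: sum.cong)
  also have "\<dots> = k * p * k' + k * (top_row G \<bullet> z') + k' * (top_row G \<bullet> z) + H"
    using q z by (simp add: H_def sum.distrib sum_distrib_left algebra_simps)
  finally show ?thesis using 1 by (simp add: p_def algebra_simps)
qed

text \<open>Gaussian elimination without division: \<open>T\<close> multiplies each lower row by the
  corner and subtracts the multiple of the top row that clears its first entry. Keeping a factor on
  the left avoids the exponent \<open>m - 1\<close>, which on natural numbers would be wrong for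
  \<open>m = 0\<close>.\<close>

lemma det_schur_mat:
  assumes G: "G \<in> carrier_mat (Suc m) (Suc m)"
  shows "G $$ (0, 0) * det (schur_mat G) = G $$ (0, 0) ^ m * det G"
proof -
  define p where "p = G $$ (0, 0)"
  define T where "T = mat (Suc m) (Suc m) (\<lambda>(i, j).
    if i = 0 then (if j = 0 then 1 else 0) else if j = 0 then - G $$ (i, 0) else if i = j then p else 0)"
  have T: "T \<in> carrier_mat (Suc m) (Suc m)" by (simp add: T_def)
  have S: "schur_mat G \<in> carrier_mat m m" using G by (simp add: schur_mat_def)
  have "det T = prod_list (diag_mat T)"
    by (rule det_lower_triangular[OF _ T]) (auto simp: T_def)
  also have "\<dots> = (\<Prod>i<Suc m. T $$ (i, i))"
    using T by (simp add: prod_list_diag_prod atLeast0LessThan)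
  also have "\<dots> = p ^ m" by (simp add: prod.lessThan_Suc_shift T_def del: prod.lessThan_Suc)
  finally have dT: "det T = p ^ m" .
  have "T * G = four_block_mat (mat 1 1 (\<lambda>_. p)) (mat 1 m (\<lambda>(i, j). G $$ (0, Suc j))) (0\<^sub>m m 1) (schur_mat G)"
    (is "_ = ?F")
  proof (rule eq_matI)
    fix i j assume "i < dim_row ?F" "j < dim_col ?F"
    hence ij: "i < Suc m" "j < Suc m" using S by auto
    have "(T * G) $$ (i, j) = (\<Sum>k<Suc m. T $$ (i, k) * G $$ (k, j))"
      using ij G T by (auto simp: scalar_prod_def atLeast0LessThan intro!: sum.cong)
    also have "\<dots> = T $$ (i, 0) * G $$ (0, j) + (\<Sum>k<m. T $$ (i, Suc k) * G $$ (Suc k, j))"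
      by (simp add: sum.lessThan_Suc_shift del: sum.lessThan_Suc)
    also have "(\<Sum>k<m. T $$ (i, Suc k) * G $$ (Suc k, j)) = (\<Sum>k<m. if Suc k = i then p * G $$ (i, j) else 0)"
      using ij by (intro sum.cong refl) (auto simp: T_def)
    also have "\<dots> = (if i = 0 then 0 else p * G $$ (i, j))"
      using ij by (cases i) auto
    also have "T $$ (i, 0) * G $$ (0, j) + \<dots> = ?F $$ (i, j)"
      using ij G S by (cases i; cases j) (auto simp: T_def p_def schur_mat_def)
    finally show "(T * G) $$ (i, j) = ?F $$ (i, j)" .
  qed (use G T S in auto)
  hence "det (T * G) = det (mat 1 1 (\<lambda>_. p)) * det (schur_mat G)"
    using S by (simp only:) (rule det_four_block_mat_lower_left_zero_col, auto)
  thus ?thesis using det_mult[OF T G] dT by (simp add: p_def det_single)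
qed

lemma posdef_mat_congruent:
  assumes G: "posdef_mat n G" and P: "P \<in> carrier_mat n n" and d: "\<bar>det P\<bar> = 1"
  shows "posdef_mat n (transpose_mat P * G * P)" "det (transpose_mat P * G * P) = det G"
proof -
  have Gc: "G \<in> carrier_mat n n" "transpose_mat G = G" using G by (auto simp: posdef_mat_def)
  have inj: "P *\<^sub>v x \<noteq> 0\<^sub>v n" if "x \<in> carrier_vec n" "x \<noteq> 0\<^sub>v n" for x
    using det_0_iff_vec_prod_zero[OF P] d that by force
  have "transpose_mat (transpose_mat P * G * P) = transpose_mat P * G * P"
    using Gc P by (simp add: transpose_mult[of _ n n _ n] assoc_mult_mat[of _ n n _ n _ n])
  moreover have "bform (transpose_mat P * G * P) x x > 0" if "x \<in> carrier_vec n" "x \<noteq> 0\<^sub>v n" for x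
    using G that inj[OF that] P by (simp add: bform_congruent[OF Gc(1) P] posdef_mat_def)
  ultimately show "posdef_mat n (transpose_mat P * G * P)"
    using P Gc by (auto simp: posdef_mat_def)
  have "det (transpose_mat P * G * P) = det P * det G * det P"
    using P Gc by (simp add: det_mult[of _ n] det_transpose[of _ n])
  also have "\<dots> = \<bar>det P\<bar> * \<bar>det P\<bar> * det G" by (simp add: abs_mult_self_eq algebra_simps)
  finally show "det (transpose_mat P * G * P) = det G" using d by simp
qed

lemma posdef_mat_corner:
  assumes "posdef_mat (Suc m) G"
  shows "G $$ (0, 0) > 0"
proof -
  let ?e = "unit_vec (Suc m) 0 :: int vec"
  have "bform G ?e ?e = G $$ (0, 0)" using assms by (intro bform_unit_vec) (auto simp: posdef_mat_def)
  moreover have "bform G ?e ?e > 0" using assms by (auto simp: posdef_mat_def)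
  ultimately show ?thesis by simp
qed

lemma posdef_mat_schur:
  assumes G: "posdef_mat (Suc m) G"
  shows "posdef_mat m (schur_mat G)"
proof -
  have Gc: "G \<in> carrier_mat (Suc m) (Suc m)" "transpose_mat G = G" using G by (auto simp: posdef_mat_def)
  define p where "p = G $$ (0, 0)"
  have p: "p > 0" using posdef_mat_corner[OF G] by (simp add: p_def)
  have sym: "G $$ (i, j) = G $$ (j, i)" if "i < Suc m" "j < Suc m" for i j
    using Gc that by (metis carrier_matD index_transpose_mat(1))
  have S: "schur_mat G \<in> carrier_mat m m" using Gc by (simp add: schur_mat_def)
  have "transpose_mat (schur_mat G) = schur_mat G"
    using Gc by (intro eq_matI) (auto simp: schur_mat_def sym)
  moreover have "bform (schur_mat G) z z > 0" if z: "z \<in> carrier_vec m" "z \<noteq> 0\<^sub>v m" for z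
  proof -
    \<comment> \<open>Up to the factor \<open>p\<close> this is the component of \<open>z\<close>
      orthogonal to the first basis vector; the square in \<open>bform_vCons\<close> vanishes on
      it.\<close>
    let ?y = "vCons (- (top_row G \<bullet> z)) (p \<cdot>\<^sub>v z)"
    have tr: "top_row G \<in> carrier_vec m" using Gc by (simp add: top_row_def)
    have "p \<cdot>\<^sub>v z \<noteq> 0\<^sub>v m"
      using z p by (auto simp: vec_eq_iff)
    hence "?y \<noteq> 0\<^sub>v (Suc m)" by (simp add: zero_vec_Suc)
    hence "p * bform G ?y ?y > 0" using G z p by (simp add: posdef_mat_def)
    also have "p * bform G ?y ?y = bform (schur_mat G) (p \<cdot>\<^sub>v z) (p \<cdot>\<^sub>v z)"
      using z tr by (simp add: bform_vCons[OF Gc] p_def)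
    also have "\<dots> = p * p * bform (schur_mat G) z z"
    proof -
      have "schur_mat G *\<^sub>v (p \<cdot>\<^sub>v z) = p \<cdot>\<^sub>v (schur_mat G *\<^sub>v z)"
        using S z by (intro mult_mat_vec_smult) auto
      thus ?thesis using z S by (simp add: bform_def)
    qed
    finally show ?thesis using p by (simp add: zero_less_mult_iff)
  qed
  ultimately show ?thesis using S by (simp add: posdef_mat_def)
qed

section \<open>Hermite's inequality\<close>

lemma mult_mat_unit_vec:
  assumes "P \<in> carrier_mat n n" "j < n"
  shows "P *\<^sub>v unit_vec n j = (col P j :: int vec)"
  using assms by (intro eq_vecI) auto

text \<open>
  Choose the basis so that its first vector \<open>b\<^sub>1\<close> has the least norm \<open>p\<close> over all bases. A short
  vector of the Schur complement lifts to a basis vector whose product with \<open>b\<^sub>1\<close> is at most \<open>p/2\<close>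
  in absolute value; its norm is at least \<open>p\<close>, which bounds \<open>3p\<^sup>2\<close> by \<open>4s\<close>.
\<close>

lemma hermite_bound:
  assumes "posdef_mat (Suc m) G"
  shows "\<exists>P \<in> carrier_mat (Suc m) (Suc m). \<bar>det P\<bar> = 1 \<and>
    3 ^ (\<Sum>i<Suc m. i) * bform G (col P 0) (col P 0) ^ Suc m \<le> 4 ^ (\<Sum>i<Suc m. i) * det G"
  using assms
proof (induction m arbitrary: G)
  case 0
  let ?e = "unit_vec 1 0 :: int vec"
  have G: "G \<in> carrier_mat 1 1" using 0 by (simp add: posdef_mat_def)
  have "bform G ?e ?e = det G" using G by (subst bform_unit_vec) (auto simp: det_single)
  thus ?case using G by (intro bexI[of _ "1\<^sub>m 1"]) auto
next
  case (Suc m')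
  define m where "m = Suc m'"
  note G = Suc.prems[folded m_def]
  have Gc: "G \<in> carrier_mat (Suc m) (Suc m)" using G by (simp add: posdef_mat_def)
  define adm where "adm P \<longleftrightarrow> P \<in> carrier_mat (Suc m) (Suc m) \<and> \<bar>det P\<bar> = 1" for P :: "int mat"
  have "adm (1\<^sub>m (Suc m))" by (simp add: adm_def)
  then obtain P where P: "adm P" and
    least: "\<And>P'. adm P' \<Longrightarrow> nat (bform G (col P 0) (col P 0)) \<le> nat (bform G (col P' 0) (col P' 0))"
    using ex_has_least_nat[of adm _ "\<lambda>P. nat (bform G (col P 0) (col P 0))"] by blast
  have Pc: "P \<in> carrier_mat (Suc m) (Suc m)" "\<bar>det P\<bar> = 1" using P by (auto simp: adm_def)
  define G' where "G' = transpose_mat P * G * P"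
  have G': "posdef_mat (Suc m) G'" "det G' = det G"
    using posdef_mat_congruent[OF G Pc] by (auto simp: G'_def)
  have G'c: "G' \<in> carrier_mat (Suc m) (Suc m)" "transpose_mat G' = G'"
    using G' by (auto simp: posdef_mat_def)
  have bform_G': "bform G' x y = bform G (P *\<^sub>v x) (P *\<^sub>v y)"
    if "x \<in> carrier_vec (Suc m)" "y \<in> carrier_vec (Suc m)" for x y
    unfolding G'_def using that Gc Pc by (intro bform_congruent) auto
  define p where "p = G' $$ (0, 0)"
  have p: "p > 0" using posdef_mat_corner[OF G'(1)] by (simp add: p_def)
  let ?e = "unit_vec (Suc m) 0 :: int vec"
  have p_eq: "p = bform G (col P 0) (col P 0)"
    using bform_unit_vec[OF G'c(1), of 0 0] bform_G'[of ?e ?e] Pc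
    by (simp add: p_def mult_mat_unit_vec)
  define S where "S = schur_mat G'"
  have S: "posdef_mat m S" using posdef_mat_schur[OF G'(1)] by (simp add: S_def)
  obtain Q where Q: "Q \<in> carrier_mat m m" "\<bar>det Q\<bar> = 1" and
    IH: "3 ^ (\<Sum>i<m. i) * bform S (col Q 0) (col Q 0) ^ m \<le> 4 ^ (\<Sum>i<m. i) * det S"
    using Suc.IH[OF S[unfolded m_def]] unfolding m_def by blast
  define z where "z = col Q 0"
  define s where "s = bform S z z"
  have z: "z \<in> carrier_vec m" using Q by (auto simp: z_def)
  define c where "c = top_row G' \<bullet> z"
  \<comment> \<open>A nearest integer to \<open>- c / p\<close>: the number \<open>p * k + c\<close>
    is the product of the lifted vector \<open>(k, z)\<close> with the first basis vector.\<close>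
  define k where "k = - ((2 * c + p) div (2 * p))"
  have "2 * (p * k + c) = (2 * c + p) mod (2 * p) - p"
    using mult_div_mod_eq[of "2 * p" "2 * c + p"] unfolding k_def by (simp add: algebra_simps)
  moreover have "0 \<le> (2 * c + p) mod (2 * p)" "(2 * c + p) mod (2 * p) < 2 * p" using p by auto
  ultimately have "\<bar>2 * (p * k + c)\<bar> \<le> \<bar>p\<bar>" by linarith
  hence k: "(2 * (p * k + c))\<^sup>2 \<le> p\<^sup>2" by (simp only: abs_le_square_iff)
  \<comment> \<open>The columns of \<open>?F\<close> are the first basis vector and lifts of the
    columns of \<open>Q\<close>, the first of them shifted by \<open>k\<close>; the swap makes
    \<open>(k, z)\<close> the leading column of a unimodular matrix.\<close>
  define R where "R = swapcols 0 1 (four_block_mat (1\<^sub>m 1) (mat 1 m (\<lambda>(i, j). if j = 0 then k else 0)) (0\<^sub>m m 1) Q)"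
    (is "R = swapcols 0 1 ?F")
  have F: "?F \<in> carrier_mat (Suc m) (Suc m)" using Q by auto
  have R: "R \<in> carrier_mat (Suc m) (Suc m)" using F by (auto simp: R_def)
  have "det ?F = det (1\<^sub>m 1) * det Q" using Q by (intro det_four_block_mat_lower_left_zero_col) auto
  hence "\<bar>det R\<bar> = 1"
    using Q F unfolding R_def by (subst det_swapcols[of _ "Suc m"]) (auto simp: m_def)
  hence "adm (P * R)" using Pc R by (simp add: adm_def det_mult[of _ "Suc m"] abs_mult)
  have colR: "col R 0 = vCons k z"
    using Q F by (intro eq_vecI) (auto simp: R_def z_def m_def vec_index_vCons)
  have "col (P * R) 0 = P *\<^sub>v vCons k z"
    using Pc R by (subst col_mult2[of _ "Suc m" "Suc m" _ "Suc m"]) (auto simp: colR)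
  hence "nat p \<le> nat (bform G' (vCons k z) (vCons k z))"
    using least[OF \<open>adm (P * R)\<close>] z by (simp add: p_eq bform_G')
  hence "p \<le> bform G' (vCons k z) (vCons k z)" using p by linarith
  hence "p * p \<le> p * bform G' (vCons k z) (vCons k z)" using p by simp
  also have "\<dots> = (p * k + c) * (p * k + c) + s"
    using bform_vCons[OF G'c z z] by (simp add: p_def c_def s_def S_def)
  finally have ps: "3 * p\<^sup>2 \<le> 4 * s" using k by (simp add: power2_eq_square algebra_simps)
  have dS: "p * det S = p ^ m * det G"
    using det_schur_mat[OF G'c(1)] G'(2) by (simp add: p_def S_def)
  let ?t = "\<Sum>i<m. i"
  \<comment> \<open>The \<open>m\<close>-th power of \<open>3 * p\<^sup>2 \<le> 4 * s\<close>
    together with the bound for \<open>S\<close> gives the claim multiplied by \<open>p ^ m\<close>: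
    \<open>dS\<close> turns \<open>p * det S\<close> into \<open>p ^ m * det G\<close>, and the
    power cancels.\<close>
  have "p ^ m * (3 ^ (?t + m) * p ^ Suc m) = p * (3 ^ ?t * (3 * p\<^sup>2) ^ m)"
    by (simp add: power_add power_mult_distrib power_mult[symmetric] mult.commute[of 2] power2_eq_square algebra_simps)
  also have "\<dots> \<le> p * (3 ^ ?t * (4 * s) ^ m)"
    using p ps by (intro mult_left_mono power_mono) auto
  also have "\<dots> = p * 4 ^ m * (3 ^ ?t * s ^ m)" by (simp add: power_mult_distrib algebra_simps)
  also have "\<dots> \<le> p * 4 ^ m * (4 ^ ?t * det S)"
    using p IH by (intro mult_left_mono) (auto simp: s_def z_def)
  also have "\<dots> = 4 ^ (?t + m) * (p * det S)" by (simp add: power_add algebra_simps)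
  also have "\<dots> = p ^ m * (4 ^ (?t + m) * det G)" by (simp add: dS)
  finally have "3 ^ (?t + m) * p ^ Suc m \<le> 4 ^ (?t + m) * det G" using p by simp
  hence "3 ^ (\<Sum>i<Suc m. i) * bform G (col P 0) (col P 0) ^ Suc m \<le> 4 ^ (\<Sum>i<Suc m. i) * det G"
    by (simp only: p_eq sum.lessThan_Suc)
  thus ?case using Pc unfolding m_def by blast
qed

section \<open>Norms of characteristic vectors modulo 8\<close>

text \<open>Cramer's rule: as \<open>det P\<close> is 1 or -1, \<open>det P\<close> times the
  adjugate is an integral inverse.\<close>

lemma abs_det_1_imp_surj:
  assumes P: "(P :: int mat) \<in> carrier_mat n n" and d: "\<bar>det P\<bar> = 1" and w: "w \<in> carrier_vec n"
  shows "\<exists>w' \<in> carrier_vec n. P *\<^sub>v w' = w"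
proof
  let ?w = "det P \<cdot>\<^sub>v (adj_mat P *\<^sub>v w)"
  show "?w \<in> carrier_vec n" using adj_mat(1)[OF P] w by auto
  have "P *\<^sub>v ?w = det P \<cdot>\<^sub>v (P *\<^sub>v (adj_mat P *\<^sub>v w))"
    using adj_mat(1)[OF P] P w by (intro mult_mat_vec_smult) auto
  also have "P *\<^sub>v (adj_mat P *\<^sub>v w) = (det P \<cdot>\<^sub>m 1\<^sub>m n) *\<^sub>v w"
    using adj_mat[OF P] P w by (metis assoc_mult_mat_vec)
  also have "det P \<cdot>\<^sub>v \<dots> = (det P * det P) \<cdot>\<^sub>v w"
    using w by (intro eq_vecI) (auto simp: scalar_prod_left_unit)
  also have "det P * det P = 1" using d by (metis abs_mult_self_eq mult_1)
  finally show "P *\<^sub>v ?w = w" by simp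
qed

lemma odd_square_cong_1_mod_8:
  assumes "odd (x :: int)"
  shows "[x\<^sup>2 = 1] (mod 8)"
proof -
  obtain k where k: "x = 2 * k + 1" using assms by (elim oddE)
  obtain j where "k * (k + 1) = 2 * j" by (meson evenE even_mult_iff even_plus_one_iff)
  hence "x\<^sup>2 - 1 = 8 * j" by (simp add: k power2_eq_square algebra_simps)
  thus ?thesis by (simp add: cong_iff_dvd_diff)
qed

text \<open>A norm 1 vector of an integral lattice spans an orthogonal summand, and the Schur
  complement describes its unimodular complement. The coordinate of a characteristic vector along
  the summand is odd, so its square adds 1 modulo 8, while the rest of the vector is characteristic
  in the complement.\<close>

lemma characteristic_norm_cong_8:
  assumes "posdef_mat n G" "det G = 1" "n \<le> 5" "w \<in> carrier_vec n"
    and "\<And>x. x \<in> carrier_vec n \<Longrightarrow> even (bform G x x + bform G x w)"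
  shows "[bform G w w = int n] (mod 8)"
  using assms
proof (induction n arbitrary: G w)
  case 0
  thus ?case by (simp add: bform_def scalar_prod_def)
next
  case (Suc m)
  note G = Suc.prems(1)
  have Gc: "G \<in> carrier_mat (Suc m) (Suc m)" using G by (simp add: posdef_mat_def)
  obtain P where Pc: "P \<in> carrier_mat (Suc m) (Suc m)" "\<bar>det P\<bar> = 1" and
    le: "3 ^ (\<Sum>i<Suc m. i) * bform G (col P 0) (col P 0) ^ Suc m \<le> 4 ^ (\<Sum>i<Suc m. i) * det G"
    using hermite_bound[OF G] by blast
  define G' where "G' = transpose_mat P * G * P"
  have G': "posdef_mat (Suc m) G'" "det G' = det G"
    using posdef_mat_congruent[OF G Pc] by (auto simp: G'_def)
  have G'c: "G' \<in> carrier_mat (Suc m) (Suc m)" "transpose_mat G' = G'"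
    using G' by (auto simp: posdef_mat_def)
  have bform_G': "bform G' x y = bform G (P *\<^sub>v x) (P *\<^sub>v y)"
    if "x \<in> carrier_vec (Suc m)" "y \<in> carrier_vec (Suc m)" for x y
    unfolding G'_def using that Gc Pc by (intro bform_congruent) auto
  define p where "p = G' $$ (0, 0)"
  have p: "p > 0" using posdef_mat_corner[OF G'(1)] by (simp add: p_def)
  let ?e = "unit_vec (Suc m) 0 :: int vec"
  have p_eq: "p = bform G (col P 0) (col P 0)"
    using bform_unit_vec[OF G'c(1), of 0 0] bform_G'[of ?e ?e] Pc
    by (simp add: p_def mult_mat_unit_vec)
  have p1: "p = 1"
  proof (rule ccontr)
    assume "p \<noteq> 1"
    hence "2 ^ Suc m \<le> p ^ Suc m" using p by (intro power_mono) auto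
    hence "3 ^ (\<Sum>i<Suc m. i) * 2 ^ Suc m \<le> (3 ^ (\<Sum>i<Suc m. i) * p ^ Suc m :: int)"
      by (intro mult_left_mono) auto
    also have "\<dots> \<le> 4 ^ (\<Sum>i<Suc m. i)" using le Suc.prems(2) by (simp only: p_eq mult_1_right)
    finally have *: "3 ^ (\<Sum>i<Suc m. i) * 2 ^ Suc m \<le> (4 ^ (\<Sum>i<Suc m. i) :: int)" .
    \<comment> \<open>With n = m + 1 and t = n (n - 1) / 2 the inequality \<open>*\<close> compares
      3^t 2^n with 4^t. It fails up to n = 5, where the two sides are 1889568 and 1048576, but would
      hold for n = 6.\<close>
    have "m = 0 \<or> m = 1 \<or> m = 2 \<or> m = 3 \<or> m = 4" using Suc.prems(3) by linarith
    thus False using * by (elim disjE) (simp_all add: eval_nat_numeral)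
  qed
  define S where "S = schur_mat G'"
  have S: "posdef_mat m S" using posdef_mat_schur[OF G'(1)] by (simp add: S_def)
  have dS: "det S = 1"
    using det_schur_mat[OF G'c(1)] G'(2) p1 Suc.prems(2) by (simp add: p_def S_def)
  obtain w' where w': "w' \<in> carrier_vec (Suc m)" "P *\<^sub>v w' = w"
    using abs_det_1_imp_surj[OF Pc Suc.prems(4)] by blast
  obtain k z where kz: "w' = vCons k z" "z \<in> carrier_vec m"
    using w'(1) by (cases w') auto
  have char: "even (bform G' x x + bform G' x w')" if "x \<in> carrier_vec (Suc m)" for x
    using Suc.prems(5)[of "P *\<^sub>v x"] that Pc w' by (simp add: bform_G')
  have b: "bform G' (vCons i x) (vCons j y) = (i + top_row G' \<bullet> x) * (j + top_row G' \<bullet> y) + bform S x y"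
    if "x \<in> carrier_vec m" "y \<in> carrier_vec m" for i j x y
    using bform_vCons[OF G'c that, of i j] p1 by (simp add: p_def S_def)
  have Sc: "S \<in> carrier_mat m m" and tr: "top_row G' \<in> carrier_vec m"
    using S G'c by (auto simp: posdef_mat_def top_row_def)
  have "[bform S z z = int m] (mod 8)"
  proof (rule Suc.IH[OF S dS])
    \<comment> \<open>Tested on \<open>vCons (- (top_row G' \<bullet> x)) x\<close>, which is
      orthogonal to the first basis vector, \<open>char\<close> speaks of \<open>S\<close>
      alone.\<close>
    show "even (bform S x x + bform S x z)" if "x \<in> carrier_vec m" for x
      using char[of "vCons (- (top_row G' \<bullet> x)) x"] that kz by (simp add: b)
  qed (use Suc.prems(3) kz in auto)
  \<comment> \<open>Tested on the first basis vector, \<open>char\<close> says that 1 plus this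
    coordinate is even.\<close>
  moreover have "odd (k + top_row G' \<bullet> z)"
  proof -
    have 0: "top_row G' \<bullet> 0\<^sub>v m = 0" "bform S (0\<^sub>v m) x = 0" if "x \<in> carrier_vec m" for x
      using tr Sc that by (auto simp: bform_def)
    show ?thesis using char[of "vCons 1 (0\<^sub>v m)"] kz by (simp add: b 0)
  qed
  hence "[(k + top_row G' \<bullet> z)\<^sup>2 = 1] (mod 8)"
    by (rule odd_square_cong_1_mod_8)
  ultimately have "[(k + top_row G' \<bullet> z)\<^sup>2 + bform S z z = 1 + int m] (mod 8)" by (intro cong_add)
  moreover have "bform G w w = (k + top_row G' \<bullet> z)\<^sup>2 + bform S z z"
    using bform_G'[OF w'(1) w'(1)] w'(2) kz by (simp add: b power2_eq_square)
  ultimately show ?case by simp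
qed

section \<open>Parity of the rank\<close>

lemma even_det_if_even_diagonal:
  assumes A: "(A :: int mat) \<in> carrier_mat n n" "transpose_mat A = A"
    and d: "\<And>i. i < n \<Longrightarrow> even (A $$ (i, i))" and n: "odd n"
  shows "even (det A)"
proof -
  \<comment> \<open>a skew-symmetric matrix congruent to \<open>A\<close> mod \<open>2\<close>; in odd size its determinant vanishes\<close>
  define A' where "A' = mat n n (\<lambda>(i, j). if i < j then A $$ (i, j) else if j < i then - A $$ (i, j) else 0)"
  have A': "A' \<in> carrier_mat n n" by (simp add: A'_def)
  have sym: "A $$ (i, j) = A $$ (j, i)" if "i < n" "j < n" for i j
    using A that by (metis carrier_matD index_transpose_mat(1))
  have "transpose_mat A' = (-1) \<cdot>\<^sub>m A'"
    by (intro eq_matI) (auto simp: A'_def sym)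
  hence "det A' = (-1) ^ n * det A'" using A' by (metis carrier_matD(2) det_smult det_transpose)
  hence "det A' = 0" using n by simp
  moreover have "[det A = det A'] (mod 2)"
    unfolding det_def'[OF A(1)] det_def'[OF A']
  proof (intro cong_sum cong_mult cong_refl cong_prod)
    fix p i assume "p \<in> {p. p permutes {0..<n}}" "i \<in> {0..<n}"
    hence "i < n" "p i < n" by (auto simp: permutes_in_image)
    thus "[A $$ (i, p i) = A' $$ (i, p i)] (mod 2)"
      using d by (auto simp: A'_def cong_def mod_minus_eq mod_eq_dvd_iff)
  qed
  ultimately show ?thesis by (simp add: cong_0_iff)
qed

text \<open>Modulo 2 the form is alternating on the orthogonal complement of \<open>w\<close>. Since
  \<open>w\<close> has odd norm, this complement is nondegenerate of dimension \<open>n - 1\<close>,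
  so \<open>n - 1\<close> is even. A determinant over the integers encodes this argument.\<close>

lemma odd_rank_if_odd_characteristic_norm:
  assumes G: "G \<in> carrier_mat n n" "transpose_mat G = G" and dG: "odd (det G)"
    and w: "w \<in> carrier_vec n" and char: "\<And>i. i < n \<Longrightarrow> even (G $$ (i, i) + (G *\<^sub>v w) $ i)"
    and odd: "odd (bform G w w)"
  shows "odd n"
proof
  assume "even n"
  \<comment> \<open>With \<open>z = Gw\<close>, the matrix with rows \<open>(0, z\<^sup>T)\<close>, \<open>(z, G + zz\<^sup>T)\<close> has even diagonal, size \<open>n + 1\<close> and
    determinant \<open>- det G \<cdot> (w\<^sup>TGw)\<close>.\<close>
  define W where "W = mat n 1 (\<lambda>(i, _). w $ i)"
  define Z where "Z = G * W"
  have W: "W \<in> carrier_mat n 1" by (simp add: W_def)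
  have Z: "Z \<in> carrier_mat n 1" "transpose_mat Z \<in> carrier_mat 1 n" using G W by (auto simp: Z_def)
  have Zi: "Z $$ (i, 0) = (G *\<^sub>v w) $ i" if "i < n" for i
  proof -
    have "col W 0 = w" using w by (intro eq_vecI) (auto simp: W_def)
    thus ?thesis using that G W by (simp add: Z_def)
  qed
  define b where "b = transpose_mat Z * W"
  have b: "b \<in> carrier_mat 1 1" using Z W by (simp add: b_def)
  have "b $$ (0, 0) = (\<Sum>i<n. Z $$ (i, 0) * w $ i)"
    using Z W by (auto simp: b_def scalar_prod_def atLeast0LessThan W_def intro!: sum.cong)
  also have "\<dots> = bform G w w"
    using G w by (auto simp: bform_def scalar_prod_def Zi atLeast0LessThan mult.commute simp del: index_mult_mat_vec intro!: sum.cong)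
  finally have b00: "b $$ (0, 0) = bform G w w" .
  define H where "H = G + Z * transpose_mat Z"
  have H: "H \<in> carrier_mat n n" using G Z by (simp add: H_def)
  define K where "K = four_block_mat (0\<^sub>m 1 1) (transpose_mat Z) Z H"
  have K: "K \<in> carrier_mat (Suc n) (Suc n)" using H by (auto simp: K_def)
  \<comment> \<open>These give the factorization \<open>K * R = T * D\<close>: the column operation
    \<open>R\<close> turns the first column of \<open>K\<close> into \<open>- b\<close> times
    \<open>(1, z)\<close>, and undoing the row operation \<open>T\<close> clears it below the corner
    and takes the rank one term out of \<open>H\<close>, leaving the block triangular
    \<open>D\<close>.\<close>
  define R where "R = four_block_mat (1\<^sub>m 1) (0\<^sub>m 1 n) (- W) (1\<^sub>m n)"
  define T where "T = four_block_mat (1\<^sub>m 1) (0\<^sub>m 1 n) Z (1\<^sub>m n)"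
  define D where "D = four_block_mat (- b) (transpose_mat Z) (0\<^sub>m n 1) G"
  have RTD: "R \<in> carrier_mat (Suc n) (Suc n)" "T \<in> carrier_mat (Suc n) (Suc n)" "D \<in> carrier_mat (Suc n) (Suc n)"
    using G b by (auto simp: R_def T_def D_def)
  have *: "Z + H * (- W) = - (Z * b)"
  proof -
    have "H * W = Z + Z * b"
      using G Z W by (simp add: H_def add_mult_distrib_mat[of _ n n] b_def Z_def[symmetric] assoc_mult_mat[of _ n 1 _ n _ 1])
    hence "H * (- W) = - (Z + Z * b)" using H W by simp
    thus ?thesis using Z b by (intro eq_matI) auto
  qed
  have "K * R = four_block_mat (- b) (transpose_mat Z) (- (Z * b)) H"
    unfolding K_def R_def using Z H W b G *
    by (subst mult_four_block_mat[of _ 1 1 _ n _ n _ _ 1 _ n]) (auto simp: b_def)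
  moreover have "T * D = four_block_mat (- b) (transpose_mat Z) (- (Z * b)) H"
    unfolding T_def D_def using Z H W b G
    by (subst mult_four_block_mat[of _ 1 1 _ n _ n _ _ 1 _ n]) (auto simp: H_def comm_add_mat[of _ n n])
  ultimately have "det K * det R = det T * det D"
    using RTD K by (metis det_mult)
  moreover have "det R = 1" "det T = 1"
    unfolding R_def T_def using W Z by (subst det_four_block_mat_upper_right_zero[of _ 1 _ n]; auto)+
  moreover have "det D = det (- b) * det G"
    unfolding D_def using Z G b by (intro det_four_block_mat_lower_left_zero_col) auto
  moreover have "det (- b) = - bform G w w" using b by (simp add: det_single b00)
  ultimately have "odd (det K)" using odd dG by simp
  moreover have "even (det K)"
  proof (rule even_det_if_even_diagonal[OF K])
    have "transpose_mat H = H"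
      using G Z by (simp add: H_def transpose_add[of _ n n] transpose_mult[of _ n 1 _ n])
    thus "transpose_mat K = K" unfolding K_def using Z H
      by (subst transpose_four_block_mat[of _ 1 1 _ n _ n]) auto
    have "even (H $$ (i, i))" if "i < n" for i
    proof -
      have "H $$ (i, i) = G $$ (i, i) + Z $$ (i, 0) * Z $$ (i, 0)"
        using that G Z by (simp add: H_def scalar_prod_def)
      thus ?thesis using char[OF that] Zi[OF that] by auto
    qed
    thus "even (K $$ (i, i))" if "i < Suc n" for i
      using that Z H by (cases i) (auto simp: K_def)
  qed (use \<open>even n\<close> in auto)
  ultimately show False by simp
qed

section \<open>Lattices and their discriminant groups\<close>

lemma real_mod_one_eq_iff: "x +o \<int> = y +o \<int> \<longleftrightarrow> x - y \<in> (\<int> :: real set)"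
proof
  assume "x +o \<int> = y +o (\<int> :: real set)"
  moreover have "x \<in> x +o \<int>" unfolding elt_set_plus_def by (auto intro!: bexI[of _ 0])
  ultimately show "x - y \<in> \<int>" by (auto simp: elt_set_plus_def)
next
  have sub: "x +o \<int> \<subseteq> y +o (\<int> :: real set)" if "x - y \<in> \<int>" for x y :: real
  proof
    fix t assume "t \<in> x +o \<int>"
    then obtain b where "b \<in> \<int>" "t = x + b" by (auto simp: elt_set_plus_def)
    thus "t \<in> y +o \<int>" unfolding elt_set_plus_def using that
      by (intro CollectI bexI[of _ "x - y + b"]) auto
  qed
  assume "x - y \<in> \<int>"
  moreover from this have "y - x \<in> \<int>" by (metis Ints_minus minus_diff_eq)
  ultimately show "x +o \<int> = y +o (\<int> :: real set)" using sub by blast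
qed

lemma lattice_basis_mem:
  assumes "lattice_basis L bs" "i < length bs"
  shows "bs ! i \<in> L"
proof -
  have "(\<Sum>j<length bs. real_of_int (if j = i then 1 else 0) *\<^sub>R bs ! j) = (\<Sum>j<length bs. if j = i then bs ! i else 0)"
    by (intro sum.cong) auto
  also have "\<dots> = bs ! i" using assms by simp
  finally have "bs ! i \<in> {\<Sum>i<length bs. real_of_int (c i) *\<^sub>R bs ! i | c. True}"
    by (intro CollectI exI[of _ "\<lambda>j. if j = i then 1 else 0"]) simp
  thus ?thesis using assms by (simp add: lattice_basis_def)
qed

lemma lattice_basis_span:
  assumes "lattice_basis L bs"
  shows "span L = span (set bs)"
proof (rule antisym)
  have "L \<subseteq> span (set bs)"
    using assms unfolding lattice_basis_def by (auto intro!: span_sum span_scale intro: span_base)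
  thus "span L \<subseteq> span (set bs)" by (intro span_minimal subspace_span)
  show "span (set bs) \<subseteq> span L"
    using lattice_basis_mem[OF assms] by (intro span_mono) (auto simp: in_set_conv_nth)
qed

lemma lattice_rank_eq:
  assumes "lattice_basis L bs"
  shows "lattice_rank L = length bs"
proof -
  have "length cs = dim L" if "lattice_basis L cs" for cs
  proof -
    have "independent (set cs)" "length cs = card (set cs)"
      using that by (auto simp: lattice_basis_def distinct_card)
    thus ?thesis using dim_span_eq_card_independent[of "set cs"] lattice_basis_span[OF that] by (metis dim_span)
  qed
  thus ?thesis unfolding lattice_rank_def using assms by (intro the_equality) auto
qed

lemma lattice_basis_closed:
  assumes "lattice_basis L bs"
  shows "0 \<in> L" "x \<in> L \<Longrightarrow> y \<in> L \<Longrightarrow> x + y \<in> L" "x \<in> L \<Longrightarrow> real_of_int k *\<^sub>R x \<in> L"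
    "x \<in> L \<Longrightarrow> - x \<in> L" "x \<in> L \<Longrightarrow> y \<in> L \<Longrightarrow> x - y \<in> L"
proof -
  define f where "f c = (\<Sum>i<length bs. real_of_int (c i) *\<^sub>R bs ! i)" for c
  have L: "L = range f" using assms by (auto simp: lattice_basis_def f_def)
  have add: "f c + f d = f (\<lambda>i. c i + d i)" for c d
    by (simp add: f_def sum.distrib scaleR_add_left)
  have scale: "real_of_int k *\<^sub>R f c = f (\<lambda>i. k * c i)" for k c
    by (simp add: f_def scaleR_sum_right)
  have "f (\<lambda>_. 0) = 0" by (simp add: f_def)
  thus "0 \<in> L" unfolding L by (metis rangeI)
  show a: "x \<in> L \<Longrightarrow> y \<in> L \<Longrightarrow> x + y \<in> L" for x y unfolding L using add by auto
  show s: "x \<in> L \<Longrightarrow> real_of_int k *\<^sub>R x \<in> L" for k x unfolding L using scale by auto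
  show m: "x \<in> L \<Longrightarrow> - x \<in> L" for x using s[of x "-1"] by simp
  show "x \<in> L \<Longrightarrow> y \<in> L \<Longrightarrow> x - y \<in> L" using a[of x "- y"] m[of y] by simp
qed

lemma sym_bilinear_on_rules:
  assumes B: "sym_bilinear_on V B" and V: "subspace V"
  shows "\<And>x y z. x \<in> V \<Longrightarrow> y \<in> V \<Longrightarrow> z \<in> V \<Longrightarrow> B (x + y) z = B x z + B y z"
    "\<And>x y z. x \<in> V \<Longrightarrow> y \<in> V \<Longrightarrow> z \<in> V \<Longrightarrow> B z (x + y) = B z x + B z y"
    "\<And>c x z. x \<in> V \<Longrightarrow> z \<in> V \<Longrightarrow> B (c *\<^sub>R x) z = c * B x z"
    "\<And>c x z. x \<in> V \<Longrightarrow> z \<in> V \<Longrightarrow> B z (c *\<^sub>R x) = c * B z x"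
    "\<And>x y. x \<in> V \<Longrightarrow> y \<in> V \<Longrightarrow> B x y = B y x"
proof -
  show add: "B (x + y) z = B x z + B y z" if "x \<in> V" "y \<in> V" "z \<in> V" for x y z
    using B that by (simp add: sym_bilinear_on_def)
  show sc: "B (c *\<^sub>R x) z = c * B x z" if "x \<in> V" "z \<in> V" for c x z
    using B that by (simp add: sym_bilinear_on_def)
  show sym: "B x y = B y x" if "x \<in> V" "y \<in> V" for x y
    using B that by (simp add: sym_bilinear_on_def)
  show "B z (x + y) = B z x + B z y" if "x \<in> V" "y \<in> V" "z \<in> V" for x y z
    using that add[OF that] sym V by (metis subspace_add)
  show "B z (c *\<^sub>R x) = c * B z x" if "x \<in> V" "z \<in> V" for c x z
    using that sc[OF that] sym V by (metis subspace_scale)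
qed

lemma sym_bilinear_on_sum:
  assumes "sym_bilinear_on V B" "subspace V" "\<And>i. i \<in> I \<Longrightarrow> x i \<in> V" "z \<in> V"
  shows "B (\<Sum>i\<in>I. c i *\<^sub>R x i) z = (\<Sum>i\<in>I. c i * B (x i) z)"
proof (cases "finite I")
  case True
  thus ?thesis using assms(3)
  proof (induction I)
    case empty
    have "B (0 *\<^sub>R z) z = 0 * B z z" using assms by (intro sym_bilinear_on_rules(3)) auto
    thus ?case by simp
  next
    case (insert i I)
    have "(\<Sum>i\<in>I. c i *\<^sub>R x i) \<in> V" "c i *\<^sub>R x i \<in> V" "x i \<in> V"
      using insert assms(2) by (auto intro!: subspace_sum subspace_scale)
    thus ?case using insert assms by (simp add: sym_bilinear_on_rules(1,3)[OF assms(1,2)])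
  qed
next
  case False
  have "B (0 *\<^sub>R z) z = 0 * B z z" using assms by (intro sym_bilinear_on_rules(3)) auto
  thus ?thesis using False by simp
qed

section \<open>Cyclic discriminant groups and their generators\<close>

definition dual_group :: "'v::real_vector set \<Rightarrow> ('v \<Rightarrow> 'v \<Rightarrow> real) \<Rightarrow> 'v monoid" where
  "dual_group L B = \<lparr>carrier = dual_lattice L B, monoid.mult = (+), one = 0\<rparr>"

lemma dual_group_simps [simp]:
  "carrier (dual_group L B) = dual_lattice L B" "monoid.mult (dual_group L B) = (+)" "one (dual_group L B) = 0"
  by (simp_all add: dual_group_def)

lemma dual_lattice_closed:
  assumes "even_lattice L B" "x \<in> dual_lattice L B" "y \<in> dual_lattice L B"
  shows "x + y \<in> dual_lattice L B" "real_of_int k *\<^sub>R x \<in> dual_lattice L B" "- x \<in> dual_lattice L B" "x - y \<in> dual_lattice L B"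
proof -
  have B: "sym_bilinear_on (span L) B" using assms by (simp add: even_lattice_def is_lattice_def)
  note bil = sym_bilinear_on_rules[OF B subspace_span]
  have add: "x + y \<in> dual_lattice L B" if "x \<in> dual_lattice L B" "y \<in> dual_lattice L B" for x y
    using that by (auto simp: dual_lattice_def span_add span_base bil(1))
  have sc: "real_of_int k *\<^sub>R x \<in> dual_lattice L B" if "x \<in> dual_lattice L B" for k x
    using that by (auto simp: dual_lattice_def span_scale span_base bil(3))
  have min: "- x \<in> dual_lattice L B" if "x \<in> dual_lattice L B" for x using sc[OF that, of "-1"] by simp
  show "x - y \<in> dual_lattice L B" using add[of x "- y"] min[of y] assms by simp
  show "x + y \<in> dual_lattice L B" "real_of_int k *\<^sub>R x \<in> dual_lattice L B" "- x \<in> dual_lattice L B"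
    using add sc min assms by auto
qed

lemma lattice_subset_dual:
  assumes "even_lattice L B"
  shows "L \<subseteq> dual_lattice L B"
  using assms by (auto simp: even_lattice_def dual_lattice_def span_base)

lemma even_latticeE:
  assumes "even_lattice L B"
  obtains bs where "lattice_basis L bs"
  using assms by (auto simp: even_lattice_def is_lattice_def)

lemma normal_dual_group:
  assumes "even_lattice L B"
  shows "comm_group (dual_group L B)" "L \<lhd> dual_group L B"
proof -
  obtain bs where bs: "lattice_basis L bs" using assms by (rule even_latticeE)
  note L = lattice_basis_closed[OF bs]
  note D = dual_lattice_closed[OF assms]
  show c: "comm_group (dual_group L B)"
  proof (rule comm_groupI)
    show "\<exists>y\<in>carrier (dual_group L B). y \<otimes>\<^bsub>dual_group L B\<^esub> x = \<one>\<^bsub>dual_group L B\<^esub>"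
      if "x \<in> carrier (dual_group L B)" for x
      using D(3)[of x x] that by (intro bexI[of _ "- x"]) auto
  qed (use D(1) L(1) lattice_subset_dual[OF assms] in \<open>auto simp: add_ac\<close>)
  then interpret comm_group "dual_group L B" .
  have inv: "inv\<^bsub>dual_group L B\<^esub> x = - x" if "x \<in> dual_lattice L B" for x
    using D that by (intro inv_equality) auto
  have "subgroup L (dual_group L B)"
    using L lattice_subset_dual[OF assms] by unfold_locales (auto simp: inv subset_iff)
  thus "L \<lhd> dual_group L B" by (rule subgroup_imp_normal)
qed

lemma mem_dual_coset:
  "x \<in> r_coset (dual_group L B) L y \<longleftrightarrow> x - y \<in> L"
  by (auto simp: r_coset_def) (metis diff_add_cancel)

text \<open>Every dual vector is \<open>l + k g\<close> with \<open>l\<close> in \<open>L\<close>,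
  and its half norm differs from \<open>k\<^sup>2\<close> times that of \<open>g\<close> by the
  integers \<open>B l l / 2\<close> and \<open>k * B g l\<close>. So the exponent \<open>k\<close>
  modulo \<open>2 ^ r\<close> is the isometry, and the norm of \<open>g\<close> matters only up to
  even integers.\<close>

lemma isometric_if_generator:
  assumes E: "even_lattice L B" and g: "g \<in> dual_lattice L B"
    and gen: "\<And>y. y \<in> dual_lattice L B \<Longrightarrow> \<exists>k::int. y - real_of_int k *\<^sub>R g \<in> L"
    and ord: "\<And>k::int. real_of_int k *\<^sub>R g \<in> L \<longleftrightarrow> 2 ^ r dvd k"
    and norm: "B g g = real_of_int a / 2 ^ r + 2 * real_of_int j"
  shows "isometrically_isomorphic (discriminant_module L B) (A_module r a)"
proof -
  let ?D = "dual_group L B" and ?Z = "integer_mod_group (2 ^ r)"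
  obtain bs where bs: "lattice_basis L bs" using E by (rule even_latticeE)
  note L = lattice_basis_closed[OF bs]
  note D = dual_lattice_closed[OF E]
  have B: "sym_bilinear_on (span L) B" using E by (simp add: even_lattice_def is_lattice_def)
  note bil = sym_bilinear_on_rules[OF B subspace_span]
  interpret comm_group ?D by (rule normal_dual_group[OF E])
  interpret normal L ?D by (rule normal_dual_group[OF E])
  \<comment> \<open>An exponent is chosen and then reduced; \<open>uniq\<close> makes the residue
    independent of the choice and of the representative of the class.\<close>
  define \<phi> where "\<phi> y = (SOME k. y - real_of_int k *\<^sub>R g \<in> L) mod 2 ^ r" for y
  have uniq: "k mod 2 ^ r = l mod 2 ^ r"
    if "y - real_of_int k *\<^sub>R g \<in> L" "z - real_of_int l *\<^sub>R g \<in> L" "y - z \<in> L" for y z k l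
  proof -
    have "(y - z) - ((y - real_of_int k *\<^sub>R g) - (z - real_of_int l *\<^sub>R g)) \<in> L" using L(5)[OF that(3) L(5)[OF that(1,2)]] .
    hence "real_of_int (k - l) *\<^sub>R g \<in> L" by (simp add: algebra_simps)
    thus ?thesis by (simp only: ord mod_eq_dvd_iff)
  qed
  have \<phi>: "\<phi> y = k mod 2 ^ r" if "y - real_of_int k *\<^sub>R g \<in> L" for y k
    unfolding \<phi>_def using L(1)
    by (intro uniq[OF someI[of "\<lambda>k. y - real_of_int k *\<^sub>R g \<in> L", OF that] that]) simp
  have \<phi>_diff: "y - real_of_int (\<phi> y) *\<^sub>R g \<in> L" if y: "y \<in> dual_lattice L B" for y
  proof -
    obtain k where k: "y - real_of_int k *\<^sub>R g \<in> L" using gen[OF y] by blast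
    have "real_of_int (k - \<phi> y) *\<^sub>R g \<in> L" unfolding ord using \<phi>[OF k] by (simp add: mod_eq_dvd_iff[symmetric])
    hence "(y - real_of_int k *\<^sub>R g) + real_of_int (k - \<phi> y) *\<^sub>R g \<in> L" by (rule L(2)[OF k])
    thus ?thesis by (simp add: algebra_simps)
  qed
  have range: "\<phi> y \<in> {0..<2 ^ r}" for y by (simp add: \<phi>_def)
  have \<phi>_add: "\<phi> (x + y) = (\<phi> x + \<phi> y) mod 2 ^ r" if "x \<in> dual_lattice L B" "y \<in> dual_lattice L B" for x y
  proof (rule \<phi>)
    have "(x - real_of_int (\<phi> x) *\<^sub>R g) + (y - real_of_int (\<phi> y) *\<^sub>R g) \<in> L" using L(2)[OF \<phi>_diff[OF that(1)] \<phi>_diff[OF that(2)]] .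
    thus "x + y - real_of_int (\<phi> x + \<phi> y) *\<^sub>R g \<in> L" by (simp add: algebra_simps)
  qed
  have hom: "\<phi> \<in> hom ?D ?Z"
    using range \<phi>_add by (auto simp: hom_def carrier_integer_mod_group)
  have \<phi>_eq: "\<phi> x = \<phi> y \<longleftrightarrow> x - y \<in> L" if "x \<in> dual_lattice L B" "y \<in> dual_lattice L B" for x y
  proof
    assume "x - y \<in> L"
    hence "\<phi> x mod 2 ^ r = \<phi> y mod 2 ^ r" using uniq \<phi>_diff that by blast
    thus "\<phi> x = \<phi> y" by (simp add: \<phi>_def)
  next
    assume "\<phi> x = \<phi> y"
    moreover have "(x - real_of_int (\<phi> x) *\<^sub>R g) - (y - real_of_int (\<phi> y) *\<^sub>R g) \<in> L" using L(5)[OF \<phi>_diff[OF that(1)] \<phi>_diff[OF that(2)]] .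
    ultimately show "x - y \<in> L" by simp
  qed
  have coset_eq: "r_coset ?D L x = r_coset ?D L y \<longleftrightarrow> x - y \<in> L" if "x \<in> dual_lattice L B" "y \<in> dual_lattice L B" for x y
    using that rcos_self[of x L] repr_independence[of x L y] subgroup_axioms mem_dual_coset[of x L B y] by auto
  obtain h where h: "h \<in> hom (?D Mod L) ?Z" "\<And>x. x \<in> dual_lattice L B \<Longrightarrow> h (r_coset ?D L x) = \<phi> x"
    using FactGroup_universal[OF hom normal_axioms] \<phi>_eq coset_eq by auto
  have "inj_on h (carrier (?D Mod L))"
    by (auto simp: inj_on_def carrier_FactGroup h(2) \<phi>_eq coset_eq)
  moreover have "h ` carrier (?D Mod L) = carrier ?Z"
  proof
    show "h ` carrier (?D Mod L) \<subseteq> carrier ?Z" using h(1) by (auto simp: hom_def)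
    show "carrier ?Z \<subseteq> h ` carrier (?D Mod L)"
    proof
      fix k assume k: "k \<in> carrier ?Z"
      have "\<phi> (real_of_int k *\<^sub>R g) = k mod 2 ^ r" using L(1) by (intro \<phi>) simp
      hence "h (r_coset ?D L (real_of_int k *\<^sub>R g)) = k"
        using k D(2)[OF g g] by (simp add: h(2) carrier_integer_mod_group)
      thus "k \<in> h ` carrier (?D Mod L)" using D(2)[OF g g, of k]
        by (auto simp: carrier_FactGroup intro!: image_eqI[of _ _ "r_coset ?D L (real_of_int k *\<^sub>R g)"])
    qed
  qed
  ultimately have "h \<in> iso (?D Mod L) ?Z" using h(1) by (simp add: iso_def bij_betw_def)
  \<comment> \<open>All representatives of a class give the same coset of the integers, and a class
    is nonempty, so the union is that coset.\<close>
  moreover have "(\<Union>v\<in>X. (B v v / 2) +o \<int>) = (real_of_int a / 2 ^ (r + 1) * (real_of_int (h X))\<^sup>2) +o \<int>"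
    if "X \<in> carrier (?D Mod L)" for X
  proof -
    obtain y where y: "y \<in> dual_lattice L B" "X = r_coset ?D L y" using \<open>X \<in> _\<close> by (auto simp: carrier_FactGroup)
    have "(B v v / 2) +o \<int> = (real_of_int a / 2 ^ (r + 1) * (real_of_int (h X))\<^sup>2) +o \<int>" if v: "v \<in> X" for v
    proof -
      have "v - y \<in> L" using v y mem_dual_coset by blast
      hence "(v - y) + y \<in> dual_lattice L B" using D(1)[OF _ y(1)] lattice_subset_dual[OF E] by blast
      hence vd: "v \<in> dual_lattice L B" by simp
      define k where "k = \<phi> v"
      define l where "l = v - real_of_int k *\<^sub>R g"
      have l: "l \<in> L" using \<phi>_diff[OF vd] by (simp add: l_def k_def)
      have hX: "h X = k" using y \<phi>_eq[OF vd y(1)] \<open>v - y \<in> L\<close> by (simp add: h(2) k_def)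
      have sp: "l \<in> span L" "g \<in> span L" "real_of_int k *\<^sub>R g \<in> span L" "l + real_of_int k *\<^sub>R g \<in> span L"
        using l g by (auto simp: dual_lattice_def span_base span_scale span_add)
      obtain e where e: "B l l = 2 * real_of_int e" using E l by (auto simp: even_lattice_def)
      obtain f where f: "B g l = real_of_int f" using g l by (auto simp: dual_lattice_def Ints_def)
      have "v = l + real_of_int k *\<^sub>R g" by (simp add: l_def)
      hence "B v v = B l l + 2 * real_of_int k * B g l + (real_of_int k)\<^sup>2 * B g g"
        using sp bil(5)[of l g] by (simp add: bil(1-4) power2_eq_square algebra_simps)
      hence "B v v / 2 - real_of_int a / 2 ^ (r + 1) * (real_of_int k)\<^sup>2 = real_of_int (e + k * f + k\<^sup>2 * j)"
        by (simp add: e f norm field_simps)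
      thus ?thesis unfolding hX real_mod_one_eq_iff by (metis Ints_of_int)
    qed
    moreover have "X \<noteq> {}" using y L(1) mem_dual_coset[of y L B y] by auto
    ultimately show ?thesis by auto
  qed
  ultimately show ?thesis
    unfolding isometrically_isomorphic_def discriminant_module_def A_module_def dual_group_def
    by (intro bexI[of _ h]) auto
qed

text \<open>Converse to \<open>isometric_if_generator\<close>: any representative of the class sent
  to 1 will do. The isometry knows its norm only modulo 2, because the quadratic form is half the
  norm modulo 1.\<close>

lemma generator_if_isometric:
  assumes E: "even_lattice L B" and r: "r > 0"
    and iso: "isometrically_isomorphic (discriminant_module L B) (A_module r a)"
  obtains g j where "g \<in> dual_lattice L B"
    "\<And>y. y \<in> dual_lattice L B \<Longrightarrow> \<exists>k::int. y - real_of_int k *\<^sub>R g \<in> L"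
    "\<And>k::int. real_of_int k *\<^sub>R g \<in> L \<longleftrightarrow> 2 ^ r dvd k"
    "B g g = real_of_int a / 2 ^ r + 2 * real_of_int j"
proof -
  let ?D = "dual_group L B" and ?Z = "integer_mod_group (2 ^ r)"
  obtain bs where bs: "lattice_basis L bs" using E by (rule even_latticeE)
  note L = lattice_basis_closed[OF bs]
  note D = dual_lattice_closed[OF E]
  interpret comm_group ?D by (rule normal_dual_group[OF E])
  interpret normal L ?D by (rule normal_dual_group[OF E])
  obtain h where h: "h \<in> iso (?D Mod L) ?Z" and
    Q: "\<And>X. X \<in> carrier (?D Mod L) \<Longrightarrow>
      (real_of_int a / 2 ^ (r + 1) * (real_of_int (h X))\<^sup>2) +o \<int> = (\<Union>v\<in>X. (B v v / 2) +o \<int>)"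
    using iso unfolding isometrically_isomorphic_def discriminant_module_def A_module_def dual_group_def by auto
  define \<psi> where "\<psi> y = h (r_coset ?D L y)" for y
  have hom: "\<psi> \<in> hom ?D ?Z"
    using Group.hom_compose[OF r_coset_hom_Mod, of h ?Z] h by (simp add: \<psi>_def[abs_def] comp_def iso_def)
  have \<psi>_add: "\<psi> (x + y) = (\<psi> x + \<psi> y) mod 2 ^ r" if "x \<in> dual_lattice L B" "y \<in> dual_lattice L B" for x y
    using hom_mult[OF hom, of x y] that by simp
  have coset_eq: "r_coset ?D L x = r_coset ?D L y \<longleftrightarrow> x - y \<in> L" if "x \<in> dual_lattice L B" "y \<in> dual_lattice L B" for x y
    using that rcos_self[of x L] repr_independence[of x L y] subgroup_axioms mem_dual_coset[of x L B y] by auto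
  have \<psi>_eq: "\<psi> x = \<psi> y \<longleftrightarrow> x - y \<in> L" if "x \<in> dual_lattice L B" "y \<in> dual_lattice L B" for x y
    using h that coset_eq[OF that] unfolding \<psi>_def iso_def bij_betw_def inj_on_def
    by (auto simp: carrier_FactGroup)
  have range: "\<psi> y \<in> {0..<2 ^ r}" if "y \<in> dual_lattice L B" for y
    using hom that by (auto simp: hom_def carrier_integer_mod_group)
  have "1 \<in> carrier ?Z" using r by simp
  moreover have "carrier ?Z = \<psi> ` dual_lattice L B"
    using h by (auto simp: iso_def bij_betw_def carrier_FactGroup \<psi>_def image_image)
  ultimately obtain g where g: "g \<in> dual_lattice L B" "\<psi> g = 1" by (metis imageE)
  have \<psi>0: "\<psi> 0 = 0"
  proof -
    have "\<psi> 0 = (\<psi> 0 + \<psi> 0) mod 2 ^ r" using \<psi>_add[of 0 0] L(1) lattice_subset_dual[OF E] by auto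
    moreover have "\<psi> 0 mod 2 ^ r = \<psi> 0" using range[of 0] L(1) lattice_subset_dual[OF E] by auto
    ultimately have "2 ^ r dvd \<psi> 0" by (metis add_diff_cancel_right' mod_eq_dvd_iff)
    thus ?thesis using \<open>\<psi> 0 mod 2 ^ r = \<psi> 0\<close> by auto
  qed
  have step: "\<psi> (real_of_int (k + 1) *\<^sub>R g) = (\<psi> (real_of_int k *\<^sub>R g) + 1) mod 2 ^ r" for k
    using \<psi>_add[OF D(2)[OF g(1) g(1)] g(1), of k] by (simp add: scaleR_add_left g)
  have \<psi>k: "\<psi> (real_of_int k *\<^sub>R g) mod 2 ^ r = k mod 2 ^ r" for k
  proof (induction k rule: int_induct[of _ 0])
    case base
    show ?case by (simp add: \<psi>0)
  next
    case (step1 i)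
    thus ?case unfolding step by (metis mod_add_left_eq mod_mod_trivial)
  next
    case (step2 i)
    have "\<psi> (real_of_int (i - 1 + 1) *\<^sub>R g) mod 2 ^ r = (\<psi> (real_of_int (i - 1) *\<^sub>R g) + 1) mod 2 ^ r"
      unfolding step by simp
    hence "(\<psi> (real_of_int (i - 1) *\<^sub>R g) + 1) mod 2 ^ r = i mod 2 ^ r" using step2 by simp
    thus ?case by (simp add: mod_eq_dvd_iff algebra_simps)
  qed
  have \<psi>k': "\<psi> (real_of_int k *\<^sub>R g) = k mod 2 ^ r" for k
    using \<psi>k[of k] range[OF D(2)[OF g(1) g(1)], of k] by simp
  have gX: "r_coset ?D L g \<in> carrier (?D Mod L)" using g by (auto simp: carrier_FactGroup)
  have "B g g / 2 \<in> (\<Union>v\<in>r_coset ?D L g. (B v v / 2) +o \<int>)"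
    using L(1) by (intro UN_I[of g]) (auto simp: mem_dual_coset elt_set_plus_def intro!: bexI[of _ 0])
  hence "B g g / 2 \<in> (real_of_int a / 2 ^ (r + 1)) +o \<int>"
    using Q[OF gX] g(2) by (simp add: \<psi>_def)
  then obtain j where j: "B g g / 2 = real_of_int a / 2 ^ (r + 1) + real_of_int j"
    by (auto simp: elt_set_plus_def Ints_def)
  show thesis
  proof (rule that[OF g(1)])
    show "\<exists>k::int. y - real_of_int k *\<^sub>R g \<in> L" if y: "y \<in> dual_lattice L B" for y
      using \<psi>_eq[OF y D(2)[OF g(1) g(1)], of "\<psi> y"] range[OF y] \<psi>k'[of "\<psi> y"] by auto
    show "real_of_int k *\<^sub>R g \<in> L \<longleftrightarrow> 2 ^ r dvd k" for k
      using \<psi>_eq[OF D(2)[OF g(1) g(1)], of 0 k] L(1) lattice_subset_dual[OF E] \<psi>k'[of k] \<psi>0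
      by (auto simp: mod_eq_0_iff_dvd)
    show "B g g = real_of_int a / 2 ^ r + 2 * real_of_int j" using j by (simp add: field_simps)
  qed
qed

section \<open>The unimodular overlattice\<close>

lemma lattice_basis_coeff_eq_0:
  assumes "lattice_basis L bs" "(\<Sum>i<length bs. t i *\<^sub>R bs ! i) = 0" "i < length bs"
  shows "t i = 0"
proof -
  have d: "distinct bs" and ind: "independent (set bs)" using assms(1) by (auto simp: lattice_basis_def)
  have bij: "bij_betw ((!) bs) {..<length bs} (set bs)" using d by (intro bij_betw_nth) auto
  define s where "s v = t (the_inv_into {..<length bs} ((!) bs) v)" for v
  have s: "s (bs ! j) = t j" if "j < length bs" for j
    using that bij unfolding s_def by (simp add: the_inv_into_f_f bij_betw_def)
  have "(\<Sum>v\<in>set bs. s v *\<^sub>R v) = (\<Sum>j<length bs. s (bs ! j) *\<^sub>R bs ! j)"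
    by (rule sum.reindex_bij_betw[OF bij, symmetric])
  also have "\<dots> = 0" using s assms(2) by simp
  finally have "s (bs ! i) = 0" using ind assms(3) by (intro independentD[of "set bs" "set bs"]) auto
  thus ?thesis using s assms(3) by simp
qed

lemma posdef_mat_det_pos:
  assumes "posdef_mat n G"
  shows "det G > 0"
  using assms
proof (induction n arbitrary: G)
  case 0
  thus ?case by (simp add: posdef_mat_def)
next
  case (Suc m)
  have p: "G $$ (0, 0) > 0" by (rule posdef_mat_corner[OF Suc.prems])
  have "G $$ (0, 0) * det (schur_mat G) = G $$ (0, 0) ^ m * det G"
    using Suc.prems by (intro det_schur_mat) (simp add: posdef_mat_def)
  moreover have "det (schur_mat G) > 0" by (rule Suc.IH[OF posdef_mat_schur[OF Suc.prems]])
  ultimately have "G $$ (0, 0) ^ m * det G > 0" using p by (metis mult_pos_pos)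
  thus ?case using p by (simp add: zero_less_mult_iff)
qed

text \<open>A multiple of \<open>u\<close> is congruent modulo \<open>L\<close> to a vector with \<open>i\<^sub>0\<close>-th coordinate \<open>1/m\<close>, which can replace the \<open>i\<^sub>0\<close>-th basis vector.\<close>

lemma cyclic_overlattice_basis:
  fixes bs :: "'v::real_vector list"
  assumes bs: "lattice_basis L bs" and m: "m > 0" and u: "real_of_int m *\<^sub>R u = (\<Sum>i<length bs. real_of_int (c i) *\<^sub>R bs ! i)"
    and i0: "i0 < length bs" "coprime (c i0) m"
  obtains b where "\<And>i. i < length bs \<Longrightarrow> \<exists>l\<in>L. \<exists>s::int. b i = l + real_of_int s *\<^sub>R u"
    "\<And>l s. l \<in> L \<Longrightarrow> \<exists>z :: nat \<Rightarrow> int. l + real_of_int s *\<^sub>R u = (\<Sum>i<length bs. real_of_int (z i) *\<^sub>R b i)"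
    "\<And>z :: nat \<Rightarrow> int. (\<Sum>i<length bs. real_of_int (z i) *\<^sub>R b i) = 0 \<Longrightarrow> (\<forall>i<length bs. z i = 0)"
proof -
  let ?n = "length bs"
  note L = lattice_basis_closed[OF bs]
  obtain k q where kq: "k * c i0 = 1 + m * q"
  proof -
    obtain k where "[c i0 * k = 1] (mod m)" using cong_solve_coprime_int[OF i0(2)] by blast
    then obtain q where "c i0 * k - 1 = m * q" by (auto simp: cong_iff_dvd_diff elim: dvdE)
    thus thesis by (intro that[of k q]) (simp add: algebra_simps)
  qed
  define rest where "rest z = (\<Sum>i\<in>{..<?n} - {i0}. real_of_int (z i) *\<^sub>R bs ! i)" for z :: "nat \<Rightarrow> int"
  \<comment> \<open>The \<open>i0\<close>-th coordinate of \<open>k u\<close> is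
    \<open>(1 + m * q) / m\<close>; removing the integer \<open>q\<close> leaves
    \<open>1 / m\<close>.\<close>
  define u' where "u' = real_of_int k *\<^sub>R u - real_of_int q *\<^sub>R bs ! i0"
  define b where "b = (\<lambda>i. if i = i0 then u' else bs ! i)"
  define f where "f z = (\<Sum>i<?n. real_of_int (z i) *\<^sub>R b i)" for z :: "nat \<Rightarrow> int"
  have split_bs: "(\<Sum>i<?n. real_of_int (z i) *\<^sub>R bs ! i) = real_of_int (z i0) *\<^sub>R bs ! i0 + rest z" for z
    unfolding rest_def using i0 by (subst sum.remove[of _ i0]) auto
  have f: "f z = real_of_int (z i0) *\<^sub>R u' + rest z" for z
  proof -
    have "f z = real_of_int (z i0) *\<^sub>R b i0 + (\<Sum>i\<in>{..<?n} - {i0}. real_of_int (z i) *\<^sub>R b i)"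
      unfolding f_def using i0 by (subst sum.remove[of _ i0]) auto
    also have "(\<Sum>i\<in>{..<?n} - {i0}. real_of_int (z i) *\<^sub>R b i) = rest z"
      unfolding rest_def by (intro sum.cong) (auto simp: b_def)
    finally show ?thesis by (simp add: b_def)
  qed
  have rest_scale: "rest (\<lambda>i. if i = i0 then x else y * z i) = real_of_int y *\<^sub>R rest z" for x y z
    unfolding rest_def scaleR_sum_right by (intro sum.cong) auto
  have mu: "real_of_int m *\<^sub>R u = real_of_int (c i0) *\<^sub>R bs ! i0 + rest c" unfolding u split_bs ..
  have kq': "real_of_int k * real_of_int (c i0) = 1 + real_of_int m * real_of_int q"
    using kq by (metis of_int_1 of_int_add of_int_mult)
  have mu': "real_of_int m *\<^sub>R u' = bs ! i0 + real_of_int k *\<^sub>R rest c"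
  proof -
    have "real_of_int m *\<^sub>R u' = real_of_int k *\<^sub>R (real_of_int m *\<^sub>R u) - (real_of_int m * real_of_int q) *\<^sub>R bs ! i0"
      by (simp add: u'_def scaleR_diff_right mult.commute)
    also have "\<dots> = (real_of_int k * real_of_int (c i0)) *\<^sub>R bs ! i0 - (real_of_int m * real_of_int q) *\<^sub>R bs ! i0 + real_of_int k *\<^sub>R rest c"
      unfolding mu by (simp add: scaleR_add_right)
    also have "\<dots> = bs ! i0 + real_of_int k *\<^sub>R rest c" unfolding kq' by (simp add: scaleR_add_left)
    finally show ?thesis .
  qed
  have f_add: "f y + f z = f (\<lambda>i. y i + z i)" for y z by (simp add: f_def sum.distrib scaleR_add_left)
  have f_scale: "real_of_int x *\<^sub>R f z = f (\<lambda>i. x * z i)" for x z by (simp add: f_def scaleR_sum_right)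
  \<comment> \<open>The coefficients come from \<open>c i0 * u' = u + q * rest c\<close>, where
    \<open>rest c\<close> involves only the unchanged basis vectors.\<close>
  have f_u: "f (\<lambda>i. if i = i0 then c i0 else (- q) * c i) = u"
  proof -
    have "f (\<lambda>i. if i = i0 then c i0 else (- q) * c i) = (real_of_int k * real_of_int (c i0)) *\<^sub>R u - (real_of_int (c i0) * real_of_int q) *\<^sub>R bs ! i0 - real_of_int q *\<^sub>R rest c"
      unfolding f rest_scale by (simp add: u'_def scaleR_diff_right mult.commute)
    also have "\<dots> = u + real_of_int q *\<^sub>R (real_of_int m *\<^sub>R u) - (real_of_int (c i0) * real_of_int q) *\<^sub>R bs ! i0 - real_of_int q *\<^sub>R rest c"
      unfolding kq' by (simp add: scaleR_add_left mult.commute)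
    also have "\<dots> = u" unfolding mu by (simp add: scaleR_add_right mult.commute)
    finally show ?thesis .
  qed
  have f_bs: "\<exists>z. bs ! i = f z" if i: "i < ?n" for i
  proof (cases "i = i0")
    case True
    have "f (\<lambda>i. if i = i0 then m else (- k) * c i) = real_of_int m *\<^sub>R u' - real_of_int k *\<^sub>R rest c"
      unfolding f rest_scale by simp
    also have "\<dots> = bs ! i0" unfolding mu' by simp
    finally show ?thesis using True by metis
  next
    case False
    have "f (\<lambda>j. if j = i then 1 else 0) = (\<Sum>j<?n. if j = i then bs ! i else 0)"
      unfolding f_def using False by (intro sum.cong) (auto simp: b_def)
    also have "\<dots> = bs ! i" using i by simp
    finally show ?thesis by metis
  qed
  show thesis
  proof
    show "\<exists>l\<in>L. \<exists>s::int. b i = l + real_of_int s *\<^sub>R u" if i: "i < ?n" for i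
    proof (cases "i = i0")
      case True
      show ?thesis
      proof (intro bexI exI)
        show "b i = (real_of_int (- q) *\<^sub>R bs ! i0) + real_of_int k *\<^sub>R u" using True by (simp add: b_def u'_def)
        show "real_of_int (- q) *\<^sub>R bs ! i0 \<in> L" by (rule L(3)[OF lattice_basis_mem[OF bs i0(1)]])
      qed
    next
      case False
      show ?thesis
      proof (intro bexI exI)
        show "b i = bs ! i + real_of_int 0 *\<^sub>R u" using False by (simp add: b_def)
        show "bs ! i \<in> L" by (rule lattice_basis_mem[OF bs i])
      qed
    qed
  next
    fix l and s :: int assume "l \<in> L"
    then obtain d where d: "l = (\<Sum>i<?n. real_of_int (d i) *\<^sub>R bs ! i)" using bs by (auto simp: lattice_basis_def)
    have "\<exists>z. (\<Sum>i<j. real_of_int (d i) *\<^sub>R bs ! i) = f z" if "j \<le> ?n" for j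
      using that
    proof (induction j)
      case 0
      have "f (\<lambda>_. 0) = 0" by (simp add: f_def)
      thus ?case by (metis lessThan_0 sum.empty)
    next
      case (Suc j)
      then obtain z where "(\<Sum>i<j. real_of_int (d i) *\<^sub>R bs ! i) = f z" by auto
      moreover obtain y where "bs ! j = f y" using f_bs[of j] Suc.prems by auto
      ultimately show ?case by (auto simp: f_scale f_add)
    qed
    then obtain z where "l = f z" using d by blast
    hence "l + real_of_int s *\<^sub>R u = f (\<lambda>i. z i + s * (if i = i0 then c i0 else (- q) * c i))"
      using f_u f_scale[of s "\<lambda>i. if i = i0 then c i0 else (- q) * c i"] f_add by metis
    hence "\<exists>z. l + real_of_int s *\<^sub>R u = f z" by blast
    thus "\<exists>z :: nat \<Rightarrow> int. l + real_of_int s *\<^sub>R u = (\<Sum>i<?n. real_of_int (z i) *\<^sub>R b i)"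
      unfolding f_def .
  next
    fix z :: "nat \<Rightarrow> int" assume "(\<Sum>i<?n. real_of_int (z i) *\<^sub>R b i) = 0"
    \<comment> \<open>Multiplied by \<open>m\<close>, a relation among the \<open>b i\<close>
      becomes one among the \<open>bs ! i\<close> whose \<open>i0\<close>-th coefficient is
      \<open>z i0\<close>. Once this is zero, the other coefficients are
      \<open>m * z i\<close>.\<close>
    hence "0 = real_of_int m *\<^sub>R f z" by (simp add: f_def)
    also have "\<dots> = real_of_int (z i0) *\<^sub>R (bs ! i0 + real_of_int k *\<^sub>R rest c) + real_of_int m *\<^sub>R rest z"
      unfolding f mu'[symmetric] by (simp add: scaleR_add_right mult.commute)
    also have "\<dots> = real_of_int (z i0) *\<^sub>R bs ! i0 + ((real_of_int (z i0) * real_of_int k) *\<^sub>R rest c + real_of_int m *\<^sub>R rest z)"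
      by (simp add: scaleR_add_right)
    also have "(real_of_int (z i0) * real_of_int k) *\<^sub>R rest c + real_of_int m *\<^sub>R rest z =
        rest (\<lambda>i. if i = i0 then z i0 else z i0 * k * c i + m * z i)"
      unfolding rest_def scaleR_sum_right sum.distrib[symmetric]
      by (intro sum.cong) (auto simp: scaleR_add_left)
    also have "real_of_int (z i0) *\<^sub>R bs ! i0 + \<dots> =
        (\<Sum>i<?n. real_of_int (if i = i0 then z i0 else z i0 * k * c i + m * z i) *\<^sub>R bs ! i)"
      unfolding split_bs by simp
    finally have 0: "real_of_int (if i = i0 then z i0 else z i0 * k * c i + m * z i) = 0" if "i < ?n" for i
      using lattice_basis_coeff_eq_0[OF bs _ that] by metis
    show "\<forall>i<?n. z i = 0"
    proof (intro allI impI)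
      fix i assume "i < ?n"
      moreover have "z i0 = 0" using 0[OF i0(1)] by simp
      ultimately show "z i = 0" using 0[of i] m by (auto split: if_splits)
    qed
  qed
qed

section \<open>Self-duality of the overlattice and its characteristic vector\<close>

text \<open>\<open>G\<close> is the Gram matrix of the overlattice \<open>M\<close> and
  \<open>w\<close> the coordinate vector of \<open>u\<close>. The determinant is obtained from
  self-duality instead of an index computation: the dual basis vectors lie in \<open>M\<close>, so
  \<open>G\<close> has an integral inverse.\<close>

lemma characteristic_vector_of_realization:
  fixes L :: "'v::real_vector set"
  assumes R: "realizes L B (A_module r a)" and r: "even r" "r > 0" and a: "odd a"
    and bs: "lattice_basis L bs"
  obtains G w where "posdef_mat (length bs) G" "det G = 1" "w \<in> carrier_vec (length bs)"
    "\<And>x. x \<in> carrier_vec (length bs) \<Longrightarrow> even (bform G x x + bform G x w)"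
    "[bform G w w = a] (mod 8)"
proof -
  define n where "n = length bs"
  have E: "even_lattice L B" and pd: "positive_definite L B"
    and iso: "isometrically_isomorphic (discriminant_module L B) (A_module r a)"
    using R by (auto simp: realizes_def)
  have Bs: "sym_bilinear_on (span L) B" using E by (simp add: even_lattice_def is_lattice_def)
  note bil = sym_bilinear_on_rules[OF Bs subspace_span]
  note bil_sum = sym_bilinear_on_sum[OF Bs subspace_span]
  note Lc = lattice_basis_closed[OF bs]
  obtain g j where g: "g \<in> dual_lattice L B"
    and gen: "\<And>y. y \<in> dual_lattice L B \<Longrightarrow> \<exists>k::int. y - real_of_int k *\<^sub>R g \<in> L"
    and ord: "\<And>k::int. real_of_int k *\<^sub>R g \<in> L \<longleftrightarrow> 2 ^ r dvd k"
    and norm: "B g g = real_of_int a / 2 ^ r + 2 * real_of_int j"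
    using generator_if_isometric[OF E r(2) iso] by metis
  define m :: int where "m = 2 ^ (r div 2)"
  have mm: "m * m = 2 ^ r" using r by (simp add: m_def power_add[symmetric] flip: mult_2)
  have m: "m > 0" "even m" using r by (auto simp: m_def)
  have mmr: "real_of_int m * real_of_int m = 2 ^ r" using mm by (metis of_int_mult of_int_numeral of_int_power)
  define u where "u = real_of_int m *\<^sub>R g"
  have mu: "real_of_int m *\<^sub>R u = real_of_int (2 ^ r) *\<^sub>R g" by (simp add: u_def mmr)
  have sp: "x \<in> span L" if "x \<in> L" for x using that by (rule span_base)
  have gs: "g \<in> span L" using g by (simp add: dual_lattice_def)
  have us: "u \<in> span L" using gs by (simp add: u_def span_scale)
  have "real_of_int m *\<^sub>R u \<in> L" unfolding mu ord by simp
  then obtain c where c: "real_of_int m *\<^sub>R u = (\<Sum>i<n. real_of_int (c i) *\<^sub>R bs ! i)"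
    using bs by (auto simp: lattice_basis_def n_def)
  \<comment> \<open>If all coordinates of \<open>m u = 2 ^ r g\<close> were even,
    \<open>2 ^ (r - 1) g\<close> would lie in \<open>L\<close>, against the order of
    \<open>g\<close>. An odd coordinate is coprime to the power of two \<open>m\<close>.\<close>
  have "\<exists>i<n. odd (c i)"
  proof (rule ccontr)
    assume "\<not> (\<exists>i<n. odd (c i))"
    hence ev: "c i = 2 * (c i div 2)" if "i < n" for i using that by simp
    have "2 *\<^sub>R (real_of_int (2 ^ (r - 1)) *\<^sub>R g) = real_of_int m *\<^sub>R u"
      unfolding mu using r by (simp add: power_eq_if)
    also have "\<dots> = 2 *\<^sub>R (\<Sum>i<n. real_of_int (c i div 2) *\<^sub>R bs ! i)"
      unfolding c scaleR_sum_right
    proof (intro sum.cong refl)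
      fix i assume "i \<in> {..<n}"
      hence "real_of_int (c i) = 2 * real_of_int (c i div 2)" using ev by (metis lessThan_iff of_int_mult of_int_numeral)
      thus "real_of_int (c i) *\<^sub>R bs ! i = 2 *\<^sub>R real_of_int (c i div 2) *\<^sub>R bs ! i" by simp
    qed
    finally have "real_of_int (2 ^ (r - 1)) *\<^sub>R g = (\<Sum>i<n. real_of_int (c i div 2) *\<^sub>R bs ! i)"
      by (simp only: scaleR_cancel_left) simp
    moreover have "(\<Sum>i<n. real_of_int (d i) *\<^sub>R bs ! i) \<in> L" for d
      using bs by (auto simp: lattice_basis_def n_def)
    ultimately have "2 ^ r dvd (2 ^ (r - 1) :: int)" using ord[of "2 ^ (r - 1)"] by (simp del: of_int_power)
    hence "(2::int) ^ r \<le> 2 ^ (r - 1)" by (intro zdvd_imp_le) auto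
    thus False using r(2) by simp
  qed
  then obtain i0 where i0: "i0 < n" "odd (c i0)" by blast
  have cop: "coprime (c i0) m" using i0 by (simp add: m_def coprime_commute)
  obtain b where bM: "\<And>i. i < n \<Longrightarrow> \<exists>l\<in>L. \<exists>s::int. b i = l + real_of_int s *\<^sub>R u"
    and Mb: "\<And>l s. l \<in> L \<Longrightarrow> \<exists>z :: nat \<Rightarrow> int. l + real_of_int s *\<^sub>R u = (\<Sum>i<n. real_of_int (z i) *\<^sub>R b i)"
    and b0: "\<And>z :: nat \<Rightarrow> int. (\<Sum>i<n. real_of_int (z i) *\<^sub>R b i) = 0 \<Longrightarrow> (\<forall>i<n. z i = 0)"
    by (rule cyclic_overlattice_basis[OF bs m(1) c[unfolded n_def] i0(1)[unfolded n_def] cop, folded n_def], rule that)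
  define M where "M = {l + real_of_int s *\<^sub>R u | l s. l \<in> L}"
  have bM: "b i \<in> M" if "i < n" for i using bM[OF that] by (auto simp: M_def)
  have uM: "u \<in> M" unfolding M_def using Lc(1) by (auto intro!: exI[of _ 0] exI[of _ 1])
  have Ms: "M \<subseteq> span L" using sp us by (auto simp: M_def intro!: span_add span_scale)
  have bs': "b i \<in> span L" if "i < n" for i using bM[OF that] Ms by blast
  have M_add: "x + y \<in> M" if "x \<in> M" "y \<in> M" for x y
  proof -
    obtain l s l' s' where "l \<in> L" "l' \<in> L" "x = l + real_of_int s *\<^sub>R u" "y = l' + real_of_int s' *\<^sub>R u"
      using \<open>x \<in> M\<close> \<open>y \<in> M\<close> by (auto simp: M_def)
    hence "x + y = (l + l') + real_of_int (s + s') *\<^sub>R u" "l + l' \<in> L" using Lc(2) by (auto simp: algebra_simps)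
    thus ?thesis unfolding M_def by blast
  qed
  have M_scale: "real_of_int k *\<^sub>R x \<in> M" if "x \<in> M" for x k
  proof -
    obtain l s where "l \<in> L" "x = l + real_of_int s *\<^sub>R u" using \<open>x \<in> M\<close> by (auto simp: M_def)
    hence "real_of_int k *\<^sub>R x = real_of_int k *\<^sub>R l + real_of_int (k * s) *\<^sub>R u" "real_of_int k *\<^sub>R l \<in> L"
      using Lc(3) by (auto simp: algebra_simps)
    thus ?thesis unfolding M_def by blast
  qed
  define F where "F x = (\<Sum>i<n. real_of_int (x $ i) *\<^sub>R b i)" for x :: "int vec"
  have M0: "0 \<in> M" using M_scale[OF uM, of 0] by simp
  have FM: "F x \<in> M" for x
  proof -
    have "(\<Sum>i<k. real_of_int (x $ i) *\<^sub>R b i) \<in> M" if "k \<le> n" for k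
      using that by (induction k) (auto intro!: M_add M_scale bM M0)
    thus ?thesis by (simp add: F_def)
  qed
  have MF: "\<exists>x\<in>carrier_vec n. y = F x" if "y \<in> M" for y
  proof -
    obtain z :: "nat \<Rightarrow> int" where "y = (\<Sum>i<n. real_of_int (z i) *\<^sub>R b i)" using \<open>y \<in> M\<close> Mb by (auto simp: M_def)
    hence "y = F (vec n z)" by (simp add: F_def)
    thus ?thesis by (intro bexI[of _ "vec n z"]) auto
  qed
  have Bgl: "\<exists>f. B l g = real_of_int f" if "l \<in> L" for l
    using g that bil(5)[OF sp[OF that] gs] by (auto simp: dual_lattice_def Ints_def)
  have key: "2 ^ r * B g g = real_of_int a + 2 * 2 ^ r * real_of_int j"
    unfolding norm by (simp add: distrib_left)
  have Buu: "B u u = real_of_int (a + 2 ^ (r + 1) * j)"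
  proof -
    have "B u u = (real_of_int m * real_of_int m) * B g g"
      using gs by (simp add: u_def bil(3,4) span_scale)
    thus ?thesis by (simp add: mmr key)
  qed
  \<comment> \<open>As \<open>m\<close> is even, \<open>u\<close> pairs evenly with
    \<open>L\<close>, in agreement with the even norms on \<open>L\<close>.\<close>
  have Blu: "\<exists>f. B l u = 2 * real_of_int f" if "l \<in> L" for l
  proof -
    obtain f where "B l g = real_of_int f" using Bgl[OF \<open>l \<in> L\<close>] by blast
    moreover obtain m' where "m = 2 * m'" using m(2) by blast
    ultimately have "B l u = 2 * real_of_int (m' * f)"
      using bil(4)[OF gs sp[OF that], of "real_of_int m"] by (simp add: u_def)
    thus ?thesis by blast
  qed
  have expand: "B (l + real_of_int s *\<^sub>R u) (l' + real_of_int s' *\<^sub>R u) =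
      B l l' + real_of_int s' * B l u + real_of_int s * B l' u + real_of_int (s * s') * B u u"
    if "l \<in> L" "l' \<in> L" for l l' s s'
    using that sp us bil(5)[of u l'] by (simp add: bil(1-4) span_add span_scale algebra_simps)
  have Mint: "\<exists>k. B x y = real_of_int k" if "x \<in> M" "y \<in> M" for x y
  proof -
    obtain l s l' s' where *: "l \<in> L" "l' \<in> L" "x = l + real_of_int s *\<^sub>R u" "y = l' + real_of_int s' *\<^sub>R u"
      using \<open>x \<in> M\<close> \<open>y \<in> M\<close> by (auto simp: M_def)
    have "B l l' \<in> \<int>" using E *(1,2) by (auto simp: even_lattice_def)
    then obtain e where e: "B l l' = real_of_int e" by (rule Ints_cases)
    obtain f f' where f: "B l u = 2 * real_of_int f" "B l' u = 2 * real_of_int f'" using Blu *(1,2) by metis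
    have "B x y = real_of_int (e + s' * (2 * f) + s * (2 * f') + s * s' * (a + 2 ^ (r + 1) * j))"
      unfolding * expand[OF *(1,2)] e f Buu by simp
    thus ?thesis by blast
  qed
  have Mchar: "\<exists>k. B x x + B x u = 2 * real_of_int k" if "x \<in> M" for x
  proof -
    obtain l s where *: "l \<in> L" "x = l + real_of_int s *\<^sub>R u" using \<open>x \<in> M\<close> by (auto simp: M_def)
    obtain e where e: "B l l = 2 * real_of_int e" using E *(1) by (auto simp: even_lattice_def)
    obtain f where f: "B l u = 2 * real_of_int f" using Blu *(1) by metis
    have xu: "B x u = B l u + real_of_int s * B u u" using * sp us by (simp add: bil(1-4) span_scale)
    \<comment> \<open>On multiples of \<open>u\<close> the characteristic property rests on
      \<open>s\<^sup>2 + s\<close> being even.\<close>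
    obtain h where h: "s * (s + 1) = 2 * h" by (meson evenE even_mult_iff even_plus_one_iff)
    have "B x x + B x u = 2 * real_of_int e + 4 * real_of_int s * real_of_int f + 2 * real_of_int f + real_of_int (s * (s + 1)) * B u u"
      unfolding xu unfolding * expand[OF *(1) *(1)] e f by (simp add: algebra_simps)
    also have "\<dots> = 2 * real_of_int (e + 2 * s * f + f + h * (a + 2 ^ (r + 1) * j))"
      unfolding h Buu by (simp add: algebra_simps)
    finally show ?thesis by blast
  qed
  \<comment> \<open>Definiteness is given on \<open>L\<close>, and \<open>m x\<close> lies in
    \<open>L\<close>.\<close>
  have Mpos: "B x x > 0" if "x \<in> M" "x \<noteq> 0" for x
  proof -
    obtain l s where *: "l \<in> L" "x = l + real_of_int s *\<^sub>R u" using \<open>x \<in> M\<close> by (auto simp: M_def)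
    have "real_of_int m *\<^sub>R x = real_of_int m *\<^sub>R l + real_of_int s *\<^sub>R (real_of_int m *\<^sub>R u)"
      unfolding * by (simp add: scaleR_add_right mult.commute)
    also have "\<dots> \<in> L" by (intro Lc(2,3) * \<open>real_of_int m *\<^sub>R u \<in> L\<close>)
    finally have "B (real_of_int m *\<^sub>R x) (real_of_int m *\<^sub>R x) > 0"
      using pd \<open>x \<noteq> 0\<close> m by (simp add: positive_definite_def)
    moreover have "B (real_of_int m *\<^sub>R x) (real_of_int m *\<^sub>R x) = real_of_int m * (real_of_int m * B x x)"
    proof -
      have "x \<in> span L" using Ms \<open>x \<in> M\<close> by blast
      thus ?thesis by (simp add: bil(3,4) span_scale)
    qed
    ultimately show ?thesis using m by (simp add: zero_less_mult_iff)
  qed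
  \<comment> \<open>For \<open>y = l + k g\<close> in the dual of \<open>M\<close>, integrality of
    the product with \<open>u\<close> forces \<open>m\<close> to divide \<open>k * a\<close>. As
    \<open>a\<close> is odd, \<open>m\<close> divides \<open>k\<close>, so \<open>k g\<close> is a
    multiple of \<open>u\<close>.\<close>
  have self_dual: "y \<in> M" if y: "y \<in> span L" "\<And>x. x \<in> M \<Longrightarrow> B y x \<in> \<int>" for y
  proof -
    have "l \<in> M" if "l \<in> L" for l using that by (force simp: M_def intro: exI[of _ 0])
    hence "y \<in> dual_lattice L B" using y by (auto simp: dual_lattice_def)
    then obtain k where k: "y - real_of_int k *\<^sub>R g \<in> L" using gen by blast
    define l where "l = y - real_of_int k *\<^sub>R g"
    have l: "l \<in> L" "y = l + real_of_int k *\<^sub>R g" using k by (auto simp: l_def)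
    obtain f where f: "B l u = 2 * real_of_int f" using Blu l(1) by metis
    obtain t where t: "B y u = real_of_int t" using y(2)[OF uM] by (auto simp: Ints_def)
    have "B y u = B l u + real_of_int k * (real_of_int m * B g g)"
      using l gs us sp[OF l(1)] by (simp add: bil(1,3) span_scale) (simp add: u_def bil(4) span_scale)
    hence "real_of_int m * real_of_int t = real_of_int m * (2 * real_of_int f) + real_of_int k * ((real_of_int m * real_of_int m) * B g g)"
      unfolding t f by (simp add: algebra_simps)
    also have "(real_of_int m * real_of_int m) * B g g = real_of_int (a + 2 * (m * m) * j)"
      using key mmr by simp
    finally have "real_of_int (m * t) = real_of_int (m * (2 * f) + k * (a + 2 * (m * m) * j))" by simp
    hence "m * t = m * (2 * f) + k * (a + 2 * (m * m) * j)" by (simp only: of_int_eq_iff)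
    hence "k * a = m * (t - 2 * f - k * 2 * m * j)" by (simp add: algebra_simps)
    hence "m dvd k * a" by simp
    moreover have "coprime m a" using a by (simp add: m_def)
    ultimately have "m dvd k" by (simp add: coprime_dvd_mult_left_iff)
    then obtain s where "k = m * s" by blast
    hence "y = l + real_of_int s *\<^sub>R u" using l by (simp add: u_def mult.commute)
    thus ?thesis using l(1) by (auto simp: M_def)
  qed
  define G where "G = mat n n (\<lambda>(i, j). \<lfloor>B (b i) (b j)\<rfloor>)"
  have Gc: "G \<in> carrier_mat n n" by (simp add: G_def)
  have Gij: "real_of_int (G $$ (i, j)) = B (b i) (b j)" if "i < n" "j < n" for i j
    using that Mint[OF bM[of i] bM[of j]] by (auto simp: G_def)
  have Gsym: "transpose_mat G = G"
    by (intro eq_matI) (auto simp: G_def bil(5)[OF bs' bs'])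
  have comb: "(\<Sum>i<n. t i *\<^sub>R b i) \<in> span L" for t by (intro span_sum span_scale bs') auto
  have form: "B (\<Sum>i<n. s i *\<^sub>R b i) (\<Sum>i<n. t i *\<^sub>R b i) = (\<Sum>i<n. \<Sum>j<n. s i * real_of_int (G $$ (i, j)) * t j)" for s t
  proof -
    have "B (\<Sum>i<n. s i *\<^sub>R b i) (\<Sum>i<n. t i *\<^sub>R b i) = (\<Sum>i<n. s i * B (\<Sum>j<n. t j *\<^sub>R b j) (b i))"
      using bs' comb bil(5)[OF bs' comb] by (subst bil_sum) (auto intro!: sum.cong)
    also have "\<dots> = (\<Sum>i<n. s i * (\<Sum>j<n. t j * B (b j) (b i)))"
      using bs' by (intro sum.cong refl) (subst bil_sum, auto)
    also have "\<dots> = (\<Sum>i<n. \<Sum>j<n. s i * real_of_int (G $$ (i, j)) * t j)"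
      unfolding sum_distrib_left by (intro sum.cong refl) (auto simp: Gij bil(5)[OF bs' bs'])
    finally show ?thesis .
  qed
  have bformF: "real_of_int (bform G x y) = B (F x) (F y)" if "x \<in> carrier_vec n" "y \<in> carrier_vec n" for x y
    unfolding bform_sum[OF Gc that] F_def form by simp
  have "F x \<noteq> 0" if "x \<in> carrier_vec n" "x \<noteq> 0\<^sub>v n" for x
    using that b0[of "\<lambda>i. x $ i"] by (auto simp: F_def)
  hence "real_of_int (bform G x x) > 0" if "x \<in> carrier_vec n" "x \<noteq> 0\<^sub>v n" for x
    using that Mpos[OF FM] by (simp add: bformF)
  hence Gpd: "posdef_mat n G" using Gc Gsym by (simp add: posdef_mat_def)
  have d: "det G > 0" by (rule posdef_mat_det_pos[OF Gpd])
  \<comment> \<open>The vector \<open>y\<close> below is the \<open>k\<close>-th dual basis vector: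
    its coordinates form the \<open>k\<close>-th column of the inverse of \<open>G\<close> over the
    rationals, and self-duality makes them integers.\<close>
  have "\<exists>z\<in>carrier_vec n. G *\<^sub>v z = unit_vec n k" if k: "k < n" for k
  proof -
    define t where "t i = real_of_int (adj_mat G $$ (i, k)) / real_of_int (det G)" for i
    define y where "y = (\<Sum>i<n. t i *\<^sub>R b i)"
    have Ac: "adj_mat G \<in> carrier_mat n n" by (rule adj_mat(1)[OF Gc])
    have yb: "B (F x) y = real_of_int (x $ k)" if x: "x \<in> carrier_vec n" for x
    proof -
      have "(\<Sum>j<n. G $$ (i, j) * adj_mat G $$ (j, k)) = (if i = k then det G else 0)" if i: "i < n" for i
      proof -
        have "(\<Sum>j<n. G $$ (i, j) * adj_mat G $$ (j, k)) = (G * adj_mat G) $$ (i, k)"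
          using i k Gc Ac by (auto simp: scalar_prod_def atLeast0LessThan intro!: sum.cong)
        thus ?thesis using adj_mat(2)[OF Gc] i k by simp
      qed
      hence *: "(\<Sum>j<n. real_of_int (G $$ (i, j)) * real_of_int (adj_mat G $$ (j, k))) = (if i = k then real_of_int (det G) else 0)" if "i < n" for i
        using that by (simp flip: of_int_mult of_int_sum)
      have "B (F x) y = (\<Sum>i<n. real_of_int (x $ i) * (\<Sum>j<n. real_of_int (G $$ (i, j)) * t j))"
        unfolding F_def y_def form by (simp add: sum_distrib_left mult.assoc)
      also have "\<dots> = (\<Sum>i<n. real_of_int (x $ i) * (if i = k then 1 else 0))"
      proof (intro sum.cong refl arg_cong2[of _ _ _ _ "(*)"])
        fix i assume "i \<in> {..<n}"
        thus "(\<Sum>j<n. real_of_int (G $$ (i, j)) * t j) = (if i = k then 1 else 0)"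
          using d *[of i] by (simp add: t_def flip: sum_divide_distrib)
      qed
      also have "\<dots> = real_of_int (x $ k)" using k by (simp add: if_distrib cong: if_cong)
      finally show ?thesis .
    qed
    have "y \<in> M"
    proof (rule self_dual)
      show ys: "y \<in> span L" unfolding y_def by (rule comb)
      show "B y x \<in> \<int>" if "x \<in> M" for x
        using MF[OF that] yb bil(5)[OF ys, of x] that Ms by auto
    qed
    then obtain z where z: "z \<in> carrier_vec n" "y = F z" using MF by blast
    have "(G *\<^sub>v z) $ i = unit_vec n k $ i" if i: "i < n" for i
    proof -
      have "real_of_int (bform G (unit_vec n i) z) = real_of_int (unit_vec n i $ k)"
        using z yb[of "unit_vec n i"] by (simp add: bformF)
      hence "bform G (unit_vec n i) z = unit_vec n i $ k" by (simp only: of_int_eq_iff)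
      moreover have "bform G (unit_vec n i) z = (G *\<^sub>v z) $ i"
        unfolding bform_def using Gc z i by (intro scalar_prod_left_unit) auto
      ultimately show ?thesis using i k by auto
    qed
    hence "G *\<^sub>v z = unit_vec n k" using Gc by (intro eq_vecI) auto
    thus ?thesis using z by blast
  qed
  then obtain z where z: "\<And>k. k < n \<Longrightarrow> z k \<in> carrier_vec n" "\<And>k. k < n \<Longrightarrow> G *\<^sub>v z k = unit_vec n k" by metis
  define N where "N = mat n n (\<lambda>(i, k). z k $ i)"
  have Nc: "N \<in> carrier_mat n n" by (simp add: N_def)
  have "G * N = 1\<^sub>m n"
  proof (rule eq_matI)
    fix i k assume "i < dim_row (1\<^sub>m n :: int mat)" "k < dim_col (1\<^sub>m n :: int mat)"
    hence ik: "i < n" "k < n" by auto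
    have "col N k = z k" using z(1)[OF ik(2)] ik by (intro eq_vecI) (auto simp: N_def)
    hence "(G * N) $$ (i, k) = (G *\<^sub>v z k) $ i" using ik Gc Nc by simp
    thus "(G * N) $$ (i, k) = 1\<^sub>m n $$ (i, k)" using z(2) ik by auto
  qed (use Gc Nc in auto)
  hence "det G * det N = 1" using det_mult[OF Gc Nc] by simp
  hence dG: "det G = 1" using d by (simp add: zmult_eq_1_iff)
  obtain w where w: "w \<in> carrier_vec n" "u = F w" using MF[OF uM] by blast
  show thesis
  proof (rule that[unfolded n_def[symmetric], OF Gpd dG w(1)])
    show "even (bform G x x + bform G x w)" if x: "x \<in> carrier_vec n" for x
    proof -
      obtain k where "B (F x) (F x) + B (F x) u = 2 * real_of_int k" using Mchar[OF FM] by blast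
      hence "real_of_int (bform G x x + bform G x w) = real_of_int (2 * k)" using x w by (simp add: bformF)
      thus ?thesis by (metis dvd_triv_left of_int_eq_iff)
    qed
    have "bform G w w = a + 2 ^ (r + 1) * j"
      using bformF[OF w(1) w(1)] w(2) Buu by (metis of_int_eq_iff)
    \<comment> \<open>Being even and positive, \<open>r\<close> is at least 2.\<close>
    moreover have "(2::int) ^ 3 dvd 2 ^ (r + 1)" using r by (intro le_imp_power_dvd) (auto elim: evenE)
    ultimately show "[bform G w w = a] (mod 8)" by (auto simp: cong_iff_dvd_diff)
  qed
qed

lemma rank_of_realization:
  fixes L :: "'v::real_vector set"
  assumes R: "realizes L B (A_module r a)" and r: "even r" "r > 0" and a: "odd a"
  shows "odd (lattice_rank L)" "lattice_rank L \<le> 5 \<Longrightarrow> [a = int (lattice_rank L)] (mod 8)"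
proof -
  have "even_lattice L B" using R by (simp add: realizes_def)
  then obtain bs where bs: "lattice_basis L bs" by (rule even_latticeE)
  define n where "n = length bs"
  have n: "lattice_rank L = n" using lattice_rank_eq[OF bs] by (simp add: n_def)
  obtain G w where G: "posdef_mat n G" "det G = 1" "w \<in> carrier_vec n"
    and char: "\<And>x. x \<in> carrier_vec n \<Longrightarrow> even (bform G x x + bform G x w)"
    and w: "[bform G w w = a] (mod 8)"
    using characteristic_vector_of_realization[OF R r a bs] unfolding n_def by metis
  show "[a = int (lattice_rank L)] (mod 8)" if "lattice_rank L \<le> 5"
    using characteristic_norm_cong_8[OF G(1,2) _ G(3) char] w that unfolding n by (metis cong_sym cong_trans)
  have Gc: "G \<in> carrier_mat n n" "transpose_mat G = G" using G by (auto simp: posdef_mat_def)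
  have "even (bform G w w) = even a" using w by (metis cong_dvd_iff cong_dvd_modulus even_numeral)
  moreover have "even (G $$ (i, i) + (G *\<^sub>v w) $ i)" if "i < n" for i
  proof -
    have "bform G (unit_vec n i) w = (G *\<^sub>v w) $ i"
      unfolding bform_def using Gc G(3) that by (intro scalar_prod_left_unit) auto
    thus ?thesis using char[of "unit_vec n i"] bform_unit_vec[OF Gc(1) that that] by simp
  qed
  ultimately show "odd (lattice_rank L)"
    using odd_rank_if_odd_characteristic_norm[OF Gc _ G(3)] G(2) a unfolding n by auto
qed

section \<open>Realizations\<close>

text \<open>Lifting by one binary digit at a time: adding \<open>2 ^ (n + 2)\<close> to an odd
  \<open>t\<close> changes \<open>t\<^sup>2 * b\<close> by an odd multiple of
  \<open>2 ^ (n + 3)\<close> and so corrects the next digit if it is wrong. The start is modulus 8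
  with \<open>t = 1\<close>.\<close>

lemma odd_square_multiple_cong_power_2:
  fixes a b :: int
  assumes "odd a" "[b = a] (mod 8)"
  shows "\<exists>t. odd t \<and> [t\<^sup>2 * b = a] (mod 2 ^ (n + 3))"
proof (induction n)
  case 0
  show ?case using assms(2) by (intro exI[of _ 1]) simp
next
  case (Suc n)
  then obtain t q where t: "odd t" and q: "t\<^sup>2 * b = a + 2 ^ (n + 3) * q"
    by (auto simp: cong_iff_dvd_diff dvd_def algebra_simps)
  have b: "odd b" using assms by (metis cong_dvd_iff cong_dvd_modulus even_numeral)
  show ?case
  proof (cases "even q")
    case True
    then obtain q' where "q = 2 * q'" by blast
    hence "t\<^sup>2 * b - a = 2 ^ (Suc n + 3) * q'" using q by (simp add: power_add)
    thus ?thesis using t by (intro exI[of _ t]) (simp add: cong_iff_dvd_diff)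
  next
    case False
    then obtain q' where q': "q + t * b = 2 * q'" using t b by (metis evenE even_mult_iff odd_even_add)
    have "(t + 2 ^ (n + 2))\<^sup>2 * b = t\<^sup>2 * b + 2 ^ (n + 3) * (t * b) + 2 ^ (n + 4) * (2 ^ n * b)"
      by (simp add: power2_eq_square power_add algebra_simps)
    also have "\<dots> = a + 2 ^ (n + 3) * (q + t * b) + 2 ^ (n + 4) * (2 ^ n * b)"
      unfolding q by (simp add: algebra_simps)
    also have "\<dots> - a = 2 ^ (Suc n + 3) * (q' + 2 ^ n * b)"
      unfolding q' by (simp add: power_add algebra_simps)
    finally show ?thesis using t
      by (intro exI[of _ "t + 2 ^ (n + 2)"]) (simp add: cong_iff_dvd_diff)
  qed
qed

text \<open>An odd multiple \<open>t g\<close> of a generator of a cyclic group of order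
  \<open>2 ^ r\<close> is again a generator, and its norm has \<open>t\<^sup>2 * b\<close> in place
  of \<open>b\<close>. The congruence modulo \<open>2 ^ (r + 3)\<close> makes this norm differ from
  \<open>a / 2 ^ r\<close> by a multiple of 8.\<close>

lemma isometric_if_generator_mod_8:
  assumes E: "even_lattice L B" and g: "g \<in> dual_lattice L B"
    and gen: "\<And>y. y \<in> dual_lattice L B \<Longrightarrow> \<exists>k::int. y - real_of_int k *\<^sub>R g \<in> L"
    and ord: "\<And>k::int. real_of_int k *\<^sub>R g \<in> L \<longleftrightarrow> 2 ^ r dvd k"
    and norm: "B g g = real_of_int b / 2 ^ r" and a: "odd a" "[b = a] (mod 8)"
  shows "isometrically_isomorphic (discriminant_module L B) (A_module r a)"
proof -
  obtain bs where bs: "lattice_basis L bs" using E by (rule even_latticeE)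
  note L = lattice_basis_closed[OF bs]
  have B: "sym_bilinear_on (span L) B" using E by (simp add: even_lattice_def is_lattice_def)
  note bil = sym_bilinear_on_rules[OF B subspace_span]
  obtain t where t: "odd t" "[t\<^sup>2 * b = a] (mod 2 ^ (r + 3))"
    using odd_square_multiple_cong_power_2[OF a] by blast
  then obtain q where q: "t\<^sup>2 * b - a = 2 ^ (r + 3) * q" by (auto simp: cong_iff_dvd_diff elim: dvdE)
  have cop: "coprime t (2 ^ r)" using t(1) by simp
  show ?thesis
  proof (rule isometric_if_generator[OF E])
    show "real_of_int t *\<^sub>R g \<in> dual_lattice L B" by (rule dual_lattice_closed(2)[OF E g g])
    show "real_of_int k *\<^sub>R (real_of_int t *\<^sub>R g) \<in> L \<longleftrightarrow> 2 ^ r dvd k" for k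
      using ord[of "k * t"] cop by (simp add: coprime_dvd_mult_left_iff coprime_commute)
    show "\<exists>k::int. y - real_of_int k *\<^sub>R (real_of_int t *\<^sub>R g) \<in> L" if "y \<in> dual_lattice L B" for y
    proof -
      obtain k where k: "y - real_of_int k *\<^sub>R g \<in> L" using gen \<open>y \<in> dual_lattice L B\<close> by blast
      obtain s where "[t * s = 1] (mod 2 ^ r)" using cong_solve_coprime_int[OF cop] by blast
      hence "2 ^ r dvd k * (1 - t * s)" by (simp add: cong_iff_dvd_diff dvd_diff_commute)
      hence "real_of_int (k * (1 - t * s)) *\<^sub>R g \<in> L" by (simp only: ord)
      hence "(y - real_of_int k *\<^sub>R g) + real_of_int (k * (1 - t * s)) *\<^sub>R g \<in> L" by (rule L(2)[OF k])
      also have "(y - real_of_int k *\<^sub>R g) + real_of_int (k * (1 - t * s)) *\<^sub>R g =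
          y - real_of_int (k * s) *\<^sub>R (real_of_int t *\<^sub>R g)"
        by (simp add: algebra_simps)
      finally show ?thesis by blast
    qed
    have "g \<in> span L" using g by (simp add: dual_lattice_def)
    hence "B (real_of_int t *\<^sub>R g) (real_of_int t *\<^sub>R g) = real_of_int (t\<^sup>2 * b) / 2 ^ r"
      by (simp add: bil(3,4) span_scale norm power2_eq_square)
    also have "t\<^sup>2 * b = a + 2 ^ (r + 3) * q" using q by simp
    finally show "B (real_of_int t *\<^sub>R g) (real_of_int t *\<^sub>R g) = real_of_int a / 2 ^ r + 2 * real_of_int (4 * q)"
      by (simp add: add_divide_distrib power_add)
  qed
qed

section \<open>Integer lattices given by a Gram matrix\<close>

definition std_vec :: "nat \<Rightarrow> nat \<Rightarrow> real" where
  "std_vec i = (\<lambda>j. if j = i then 1 else 0)"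

lemma sum_fun_apply: "(\<Sum>a\<in>A. f a) x = (\<Sum>a\<in>A. f a x)"
  for f :: "'a \<Rightarrow> 'b \<Rightarrow> 'c::comm_monoid_add"
  by (induction A rule: infinite_finite_induct) (simp_all add: zero_fun_def plus_fun_def)

lemma sum_std_vec: "(\<Sum>i<n. c i *\<^sub>R std_vec i) = (\<lambda>i. if i < n then c i else 0)"
proof
  fix j
  have "(\<Sum>i<n. c i *\<^sub>R std_vec i) j = (\<Sum>i<n. if i = j then c j else 0)"
    unfolding sum_fun_apply by (intro sum.cong) (auto simp: scaleR_fun_def std_vec_def)
  thus "(\<Sum>i<n. c i *\<^sub>R std_vec i) j = (if j < n then c j else 0)" by simp
qed

lemma lattice_basis_Z_lattice: "lattice_basis (Z_lattice n) (map std_vec [0..<n])"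
proof -
  have inj: "inj std_vec" by (auto simp: inj_def std_vec_def fun_eq_iff split: if_splits)
  have "independent (std_vec ` {..<n})"
  proof -
    have "u (std_vec j) = 0" if "(\<Sum>v\<in>std_vec ` {..<n}. u v *\<^sub>R v) = 0" "j < n" for u j
    proof -
      have "(\<Sum>v\<in>std_vec ` {..<n}. u v *\<^sub>R v) = (\<Sum>i<n. u (std_vec i) *\<^sub>R std_vec i)"
        using inj by (subst sum.reindex) (auto intro: inj_on_subset)
      hence "(\<lambda>i. if i < n then u (std_vec i) else 0) = 0" using that(1) by (simp add: sum_std_vec)
      thus ?thesis using that(2) by (auto simp: fun_eq_iff zero_fun_def split: if_splits)
    qed
    thus ?thesis by (auto simp: dependent_finite)
  qed
  moreover have "Z_lattice n = {\<Sum>i<n. real_of_int (c i) *\<^sub>R std_vec i | c. True}"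
  proof (intro equalityI subsetI)
    fix x assume x: "x \<in> Z_lattice n"
    have "x = (\<Sum>i<n. real_of_int \<lfloor>x i\<rfloor> *\<^sub>R std_vec i)"
      using x by (auto simp: sum_std_vec Z_lattice_def fun_eq_iff)
    thus "x \<in> {\<Sum>i<n. real_of_int (c i) *\<^sub>R std_vec i | c. True}"
      by (intro CollectI exI[of _ "\<lambda>i. \<lfloor>x i\<rfloor>"]) simp
  qed (auto simp: sum_std_vec Z_lattice_def)
  moreover have "set (map std_vec [0..<n]) = std_vec ` {..<n}" by auto
  moreover have "distinct (map std_vec [0..<n])" using inj by (auto simp: distinct_map intro: inj_on_subset)
  ultimately show ?thesis by (simp add: lattice_basis_def)
qed

lemma lattice_rank_Z_lattice: "lattice_rank (Z_lattice n) = n"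
  using lattice_rank_eq[OF lattice_basis_Z_lattice[of n]] by simp

lemma span_Z_lattice: "span (Z_lattice n) = {x. \<forall>i\<ge>n. x i = 0}"
proof (rule antisym)
  have "subspace {x :: nat \<Rightarrow> real. \<forall>i\<ge>n. x i = 0}"
    by (auto simp: subspace_def zero_fun_def plus_fun_def scaleR_fun_def)
  thus "span (Z_lattice n) \<subseteq> {x. \<forall>i\<ge>n. x i = 0}"
    by (intro span_minimal) (auto simp: Z_lattice_def)
  show "{x. \<forall>i\<ge>n. x i = 0} \<subseteq> span (Z_lattice n)"
  proof
    fix x :: "nat \<Rightarrow> real" assume "x \<in> {x. \<forall>i\<ge>n. x i = 0}"
    hence "x = (\<Sum>i<n. x i *\<^sub>R std_vec i)" by (auto simp: sum_std_vec fun_eq_iff)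
    also have "\<dots> \<in> span (Z_lattice n)"
      by (intro span_sum span_scale span_base) (auto simp: Z_lattice_def std_vec_def)
    finally show "x \<in> span (Z_lattice n)" .
  qed
qed

lemma gram_form_sum:
  assumes "G \<in> carrier_mat n n"
  shows "gram_form G x y = (\<Sum>i<n. x i * (\<Sum>j<n. G $$ (i, j) * y j))"
  using assms by (auto simp: gram_form_def scalar_prod_def atLeast0LessThan intro!: sum.cong)

text \<open>Off-diagonal terms occur twice by symmetry, and the diagonal terms carry the even
  factors \<open>h i i\<close>.\<close>

lemma even_quadratic_form:
  fixes h :: "nat \<Rightarrow> nat \<Rightarrow> int"
  assumes "\<And>i j. i < n \<Longrightarrow> j < n \<Longrightarrow> h i j = h j i" "\<And>i. i < n \<Longrightarrow> even (h i i)"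
  shows "even (\<Sum>i<n. z i * (\<Sum>j<n. h i j * z j))"
  using assms
proof (induction n)
  case (Suc n)
  have "(\<Sum>i<n. z i * (h i n * z n)) = z n * (\<Sum>j<n. h n j * z j)"
    using Suc.prems(1) by (auto simp: sum_distrib_left intro!: sum.cong)
  thus ?case using Suc by (simp add: distrib_left sum.distrib)
qed simp

text \<open>The generator is the first standard vector divided by \<open>2 ^ r\<close>:
  \<open>head\<close> puts it into the dual lattice and gives its norm \<open>b / 2 ^ r\<close>,
  while \<open>dual\<close> leaves a dual vector no denominators except powers of two up to
  \<open>2 ^ r\<close> in its first coordinate. As \<open>pos\<close> speaks of real vectors, it
  yields the nonzero determinant as well as definiteness.\<close>

lemma realizes_Z_lattice:
  assumes G: "G \<in> carrier_mat n n" and n: "n > 0"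
    and int: "\<And>i j. i < n \<Longrightarrow> j < n \<Longrightarrow> G $$ (i, j) \<in> \<int>"
    and sym: "\<And>i j. i < n \<Longrightarrow> j < n \<Longrightarrow> G $$ (i, j) = G $$ (j, i)"
    and ev: "\<And>i. i < n \<Longrightarrow> \<exists>k::int. G $$ (i, i) = 2 * real_of_int k"
    and pos: "\<And>x i. gram_form G x x \<le> 0 \<Longrightarrow> i < n \<Longrightarrow> x i = 0"
    and head: "G $$ (0, 0) = real_of_int b * 2 ^ r" "\<And>j. j < n \<Longrightarrow> G $$ (0, j) / 2 ^ r \<in> \<int>"
    and dual: "\<And>y i. (\<And>i. i < n \<Longrightarrow> (\<Sum>j<n. G $$ (i, j) * y j) \<in> \<int>) \<Longrightarrow>
      i < n \<Longrightarrow> (if i = 0 then 2 ^ r * y 0 else y i) \<in> \<int>"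
    and a: "odd a" "[b = a] (mod 8)"
  shows "realizes (Z_lattice n) (gram_form G) (A_module r a)"
proof -
  let ?L = "Z_lattice n" and ?B = "gram_form G"
  note B = gram_form_sum[OF G]
  have B_sym: "?B x y = ?B y x" for x y
  proof -
    have "?B x y = (\<Sum>i<n. \<Sum>j<n. x i * (G $$ (i, j) * y j))" by (simp add: B sum_distrib_left)
    also have "\<dots> = (\<Sum>j<n. \<Sum>i<n. x i * (G $$ (i, j) * y j))" by (rule sum.swap)
    also have "\<dots> = ?B y x" unfolding B sum_distrib_left by (intro sum.cong refl) (simp add: sym)
    finally show ?thesis .
  qed
  have bil: "sym_bilinear_on (span ?L) ?B"
    unfolding sym_bilinear_on_def
  proof (intro conjI ballI allI)
    fix x y show "?B x y = ?B y x" by (rule B_sym)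
  next
    fix x y z show "?B (x + y) z = ?B x z + ?B y z"
      by (simp add: B plus_fun_def distrib_right sum.distrib)
  next
    fix c x y show "?B (c *\<^sub>R x) y = c * ?B x y"
      by (simp add: B scaleR_fun_def sum_distrib_left mult.assoc)
  qed
  have B_std: "?B (std_vec i) y = (\<Sum>j<n. G $$ (i, j) * y j)" if "i < n" for i y
  proof -
    have "?B (std_vec i) y = (\<Sum>k<n. if k = i then (\<Sum>j<n. G $$ (i, j) * y j) else 0)"
      unfolding B by (intro sum.cong) (auto simp: std_vec_def)
    thus ?thesis using that by simp
  qed
  have B_std2: "?B (std_vec i) (std_vec j) = G $$ (i, j)" if "i < n" "j < n" for i j
  proof -
    have "?B (std_vec i) (std_vec j) = (\<Sum>k<n. if k = j then G $$ (i, j) else 0)"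
      unfolding B_std[OF that(1)] by (intro sum.cong) (auto simp: std_vec_def)
    thus ?thesis using that by simp
  qed
  have "gram_matrix ?B (map std_vec [0..<n]) = G"
    using G by (intro eq_matI) (auto simp: gram_matrix_def B_std2)
  moreover have "det G \<noteq> 0"
  proof
    assume "det G = 0"
    then obtain v where v: "v \<in> carrier_vec n" "v \<noteq> 0\<^sub>v n" "G *\<^sub>v v = 0\<^sub>v n"
      using det_0_iff_vec_prod_zero_field[OF G] by blast
    define x where "x i = v $ i" for i
    have "vec n x = v" using v by (auto simp: x_def)
    hence "?B x x = 0" using G v by (simp add: gram_form_def)
    hence "v $ i = 0" if "i < n" for i using pos[of x i] that by (simp add: x_def)
    thus False using v by auto
  qed
  ultimately have lat: "is_lattice ?L ?B"
    using bil lattice_basis_Z_lattice[of n] unfolding is_lattice_def by metis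
  define h where "h i j = \<lfloor>G $$ (i, j)\<rfloor>" for i j
  have h: "G $$ (i, j) = real_of_int (h i j)" if "i < n" "j < n" for i j
    using int[OF that] by (simp add: h_def)
  have Z: "\<exists>z :: nat \<Rightarrow> int. \<forall>i<n. x i = real_of_int (z i)" if "x \<in> ?L" for x
    using that by (intro exI[of _ "\<lambda>i. \<lfloor>x i\<rfloor>"]) (auto simp: Z_lattice_def)
  have E: "even_lattice ?L ?B"
    unfolding even_lattice_def
  proof (intro conjI ballI lat)
    fix x y assume "x \<in> ?L" "y \<in> ?L"
    thus "?B x y \<in> \<int>" unfolding B using int by (intro Ints_sum Ints_mult) (auto simp: Z_lattice_def)
  next
    fix x assume "x \<in> ?L"
    then obtain z :: "nat \<Rightarrow> int" where z: "\<And>i. i < n \<Longrightarrow> x i = real_of_int (z i)" using Z by blast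
    have "?B x x = real_of_int (\<Sum>i<n. z i * (\<Sum>j<n. h i j * z j))"
      unfolding B using z h by simp
    moreover have "even (\<Sum>i<n. z i * (\<Sum>j<n. h i j * z j))"
    proof (rule even_quadratic_form)
      show "h i j = h j i" if "i < n" "j < n" for i j using sym[OF that] by (simp add: h_def)
      show "even (h i i)" if i: "i < n" for i
      proof -
        obtain k where "G $$ (i, i) = 2 * real_of_int k" using ev[OF i] by blast
        hence "h i i = 2 * k" using h[OF i i] by linarith
        thus ?thesis by simp
      qed
    qed
    ultimately show "\<exists>k::int. ?B x x = 2 * real_of_int k" by (metis evenE of_int_mult of_int_numeral)
  qed
  have pd: "positive_definite ?L ?B"
    unfolding positive_definite_def
  proof (intro ballI impI)
    fix x assume x: "x \<in> ?L" "x \<noteq> 0"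
    show "?B x x > 0"
    proof (rule ccontr)
      assume "\<not> ?B x x > 0"
      hence "x i = 0" for i using pos[of x i] x(1) by (cases "i < n") (auto simp: Z_lattice_def)
      thus False using x(2) by (auto simp: fun_eq_iff)
    qed
  qed
  define g where "g = (1 / 2 ^ r) *\<^sub>R std_vec 0"
  have g0: "g i = (if i = 0 then 1 / 2 ^ r else 0)" for i
    by (auto simp: g_def scaleR_fun_def std_vec_def)
  have Bg: "?B g y = (\<Sum>j<n. G $$ (0, j) / 2 ^ r * y j)" for y
  proof -
    have "?B g y = (\<Sum>i<n. if i = 0 then (1 / 2 ^ r) * (\<Sum>j<n. G $$ (0, j) * y j) else 0)"
      unfolding B by (intro sum.cong) (auto simp: g0)
    thus ?thesis using n by (simp add: sum_distrib_left sum_divide_distrib)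
  qed
  have kg: "real_of_int k *\<^sub>R g \<in> ?L \<longleftrightarrow> 2 ^ r dvd k" for k
  proof -
    have "real_of_int k *\<^sub>R g \<in> ?L \<longleftrightarrow> real_of_int k / 2 ^ r \<in> \<int>"
      using n by (auto simp: Z_lattice_def scaleR_fun_def g0)
    also have "\<dots> \<longleftrightarrow> 2 ^ r dvd k"
    proof
      assume "real_of_int k / 2 ^ r \<in> \<int>"
      then obtain q where "real_of_int k / 2 ^ r = real_of_int q" by (rule Ints_cases)
      hence "real_of_int k = real_of_int (2 ^ r * q)" by (simp add: field_simps)
      hence "k = 2 ^ r * q" by (simp only: of_int_eq_iff)
      thus "2 ^ r dvd k" by simp
    next
      assume "2 ^ r dvd k"
      then obtain q where "k = 2 ^ r * q" by blast
      thus "real_of_int k / 2 ^ r \<in> \<int>" by simp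
    qed
    finally show ?thesis .
  qed
  have "isometrically_isomorphic (discriminant_module ?L ?B) (A_module r a)"
  proof (rule isometric_if_generator_mod_8[OF E _ _ kg _ a])
    show "g \<in> dual_lattice ?L ?B"
      unfolding dual_lattice_def span_Z_lattice
      using n head(2) by (auto simp: g0 Bg Z_lattice_def simp del: times_divide_eq_left intro!: Ints_sum Ints_mult)
    have "?B g g = (\<Sum>j<n. if j = 0 then G $$ (0, 0) / 2 ^ r * (1 / 2 ^ r) else 0)"
      unfolding Bg by (intro sum.cong) (auto simp: g0)
    thus "?B g g = real_of_int b / 2 ^ r" using n head(1) by simp
    show "\<exists>k::int. y - real_of_int k *\<^sub>R g \<in> ?L" if y: "y \<in> dual_lattice ?L ?B" for y
    proof -
      have "(\<Sum>j<n. G $$ (i, j) * y j) \<in> \<int>" if i: "i < n" for i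
      proof -
        have "std_vec i \<in> ?L" using i by (auto simp: Z_lattice_def std_vec_def)
        hence "?B y (std_vec i) \<in> \<int>" using y by (simp add: dual_lattice_def)
        thus ?thesis using B_std[OF i] B_sym by metis
      qed
      note d = dual[OF this]
      obtain k where k: "2 ^ r * y 0 = real_of_int k" using d[OF _ n] by (auto elim: Ints_cases)
      have "y i = 0" if "i \<ge> n" for i using y that by (auto simp: dual_lattice_def span_Z_lattice)
      moreover have "y i \<in> \<int>" if "i < n" "i \<noteq> 0" for i using d[OF _ that(1)] that(2) by simp
      moreover have "y 0 = real_of_int k / 2 ^ r" using k by (simp add: field_simps)
      ultimately have "y - real_of_int k *\<^sub>R g \<in> ?L"
        using n by (auto simp: Z_lattice_def scaleR_fun_def g0)
      thus ?thesis by blast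
    qed
  qed
  thus ?thesis using E pd by (simp add: realizes_def)
qed

section \<open>Bordered matrices and reduction to their tail\<close>

text \<open>Bezout. For a dual vector \<open>y\<close> it is applied to \<open>2 ^ r * y 0\<close>,
  of which the first two rows of the Gram matrix control the \<open>p\<close>-fold and the
  \<open>v\<close>-fold.\<close>

lemma Ints_of_coprime_multiples:
  fixes y :: real and p v :: int
  assumes "coprime p v" "real_of_int p * y \<in> \<int>" "real_of_int v * y \<in> \<int>"
  shows "y \<in> \<int>"
proof -
  obtain s t where "s * p + t * v = 1" using bezout_int[of p v] assms(1) by auto
  hence "real_of_int s * real_of_int p + real_of_int t * real_of_int v = 1"
    by (metis of_int_1 of_int_add of_int_mult)
  hence "y = real_of_int s * (real_of_int p * y) + real_of_int t * (real_of_int v * y)"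
    by (simp flip: distrib_right mult.assoc)
  moreover have "real_of_int s * (real_of_int p * y) + real_of_int t * (real_of_int v * y) \<in> \<int>"
    by (intro Ints_add Ints_mult[OF Ints_of_int] assms)
  ultimately show ?thesis by simp
qed

lemma bordered_matrix_carrier: "bordered_matrix p q s k \<in> carrier_mat (k + 2) (k + 2)"
  by (auto simp: bordered_matrix_def F_matrix_def mat_of_rows_list_def)

lemma bordered_matrix_index:
  assumes "i < k + 2" "j < k + 2"
  shows "bordered_matrix p q s k $$ (i, j) =
    (if i = 0 \<and> j = 0 then p else if i + j = 1 then q else if i = 1 \<and> j = 1 then s
     else if i = 0 \<or> j = 0 then 0 else if i = j then 2 else if i = Suc j \<or> j = Suc i then 1 else 0)"
proof -
  have "i = 0 \<or> i = 1 \<or> (\<exists>i'. i = i' + 2)" "j = 0 \<or> j = 1 \<or> (\<exists>j'. j = j' + 2)" by presburger+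
  thus ?thesis
    using assms unfolding bordered_matrix_def
    by (elim disjE exE) (auto simp: F_matrix_def mat_of_rows_list_def mat_of_rows_def mat_of_cols_def unit_vec_def)
qed

lemma mat_3_eq_bordered_matrix:
  "mat_of_rows_list 3 [[p, q, 0], [q, s, 1], [0, 1, 2]] = bordered_matrix p q s 1"
proof (rule eq_matI)
  fix i j assume "i < dim_row (bordered_matrix p q s 1)" "j < dim_col (bordered_matrix p q s 1)"
  hence ij: "i < 1 + 2" "j < 1 + 2" using bordered_matrix_carrier[of p q s 1] by auto
  hence "i = 0 \<or> i = 1 \<or> i = 2" "j = 0 \<or> j = 1 \<or> j = 2" by auto
  thus "mat_of_rows_list 3 [[p, q, 0], [q, s, 1], [0, 1, 2]] $$ (i, j) = bordered_matrix p q s 1 $$ (i, j)"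
    unfolding bordered_matrix_index[OF ij]
    by (elim disjE) (auto simp: mat_of_rows_list_def)
qed (use bordered_matrix_carrier[of p q s 1] in \<open>auto simp: mat_of_rows_list_def\<close>)

text \<open>Separates the entries that depend on \<open>r\<close>, \<open>v\<close> and
  \<open>x\<close> from a fixed tail, so that what remains to be checked is numerical.\<close>

lemma bordered_matrix_row_sum:
  assumes "k > 0" "i < k + 2"
  shows "(\<Sum>j<k + 2. bordered_matrix p q s k $$ (i, j) * y j) =
    (\<Sum>j<k + 2. bordered_matrix 0 0 0 k $$ (i, j) * y j) +
    (if i = 0 then p * y 0 + q * y 1 else if i = 1 then q * y 0 + s * y 1 else 0)"
proof -
  have split: "(\<Sum>j<k + 2. f j) = f 0 + f 1 + (\<Sum>j<k. f (j + 2))" for f :: "nat \<Rightarrow> real"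
    by (simp add: sum.lessThan_Suc_shift del: sum.lessThan_Suc)
  have "(\<Sum>j<k. bordered_matrix p q s k $$ (i, j + 2) * y (j + 2)) =
      (\<Sum>j<k. bordered_matrix 0 0 0 k $$ (i, j + 2) * y (j + 2))"
    using assms by (intro sum.cong refl) (auto simp: bordered_matrix_index)
  thus ?thesis unfolding split using assms by (auto simp: bordered_matrix_index)
qed

lemma gram_form_bordered_matrix:
  assumes "k > 0"
  shows "gram_form (bordered_matrix p q s k) y y =
    p * (y 0)\<^sup>2 + 2 * q * y 0 * y 1 + s * (y 1)\<^sup>2 + gram_form (bordered_matrix 0 0 0 k) y y"
proof -
  let ?d = "\<lambda>i. if i = 0 then p * y 0 + q * y 1 else if i = 1 then q * y 0 + s * y 1 else 0"
  have "gram_form (bordered_matrix p q s k) y y =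
      gram_form (bordered_matrix 0 0 0 k) y y + (\<Sum>i<k + 2. y i * ?d i)"
    unfolding gram_form_sum[OF bordered_matrix_carrier] sum.distrib[symmetric]
  proof (intro sum.cong refl)
    fix i assume "i \<in> {..<k + 2}"
    thus "y i * (\<Sum>j<k + 2. bordered_matrix p q s k $$ (i, j) * y j) =
        y i * (\<Sum>j<k + 2. bordered_matrix 0 0 0 k $$ (i, j) * y j) + y i * ?d i"
      using bordered_matrix_row_sum[OF assms, of i p q s y] by (simp only: lessThan_iff distrib_left)
  qed
  also have "(\<Sum>i<k + 2. y i * ?d i) = y 0 * (p * y 0 + q * y 1) + y 1 * (q * y 0 + s * y 1)"
    by (simp add: sum.lessThan_Suc_shift del: sum.lessThan_Suc)
  finally show ?thesis by (simp add: power2_eq_square algebra_simps)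
qed

text \<open>
  The form is \<open>2\<^sup>r/p (p y\<^sub>0 + v y\<^sub>1)\<^sup>2\<close> plus \<open>2c/p y\<^sub>1\<^sup>2\<close> plus the form of the bordered matrix with zero
  upper left block, and \<open>p\<close> times the second row minus \<open>v\<close> times the first is \<open>2c y\<^sub>1 + p y\<^sub>2\<close>. This
  reduces definiteness and the computation of the dual to the last \<open>k + 1\<close> coordinates.
\<close>

lemma realizes_bordered_matrix:
  fixes v c p a :: int and x :: real
  assumes r: "r > 0" and p: "p > 0" and k: "k > 0"
    and v: "[2 ^ (r - 1) * v\<^sup>2 = - c] (mod p)" "coprime p c"
    and x: "x = (2 ^ (r - 1) * (real_of_int v)\<^sup>2 + real_of_int c) / real_of_int p"
    and a: "odd a" "[p = a] (mod 8)"
    and tail_pos: "\<And>y i. 2 * real_of_int c / real_of_int p * (y 1)\<^sup>2 +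
        gram_form (bordered_matrix 0 0 0 k) y y \<le> 0 \<Longrightarrow> 0 < i \<Longrightarrow> i < k + 2 \<Longrightarrow> y i = 0"
    and tail_dual: "\<And>y :: nat \<Rightarrow> real. \<And>i. 2 * real_of_int c * y 1 + real_of_int p * y 2 \<in> \<int> \<Longrightarrow>
        (\<And>i. 2 \<le> i \<Longrightarrow> i < k + 2 \<Longrightarrow> (\<Sum>j<k + 2. bordered_matrix 0 0 0 k $$ (i, j) * y j) \<in> \<int>) \<Longrightarrow>
        0 < i \<Longrightarrow> i < k + 2 \<Longrightarrow> y i \<in> \<int>"
  shows "realizes (Z_lattice (k + 2))
    (gram_form (bordered_matrix (real_of_int p * 2 ^ r) (2 ^ r * real_of_int v) (2 * x) k)) (A_module r a)"
proof -
  define G where "G = bordered_matrix (real_of_int p * 2 ^ r) (2 ^ r * real_of_int v) (2 * x) k"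
  have Gc: "G \<in> carrier_mat (k + 2) (k + 2)" by (simp only: G_def bordered_matrix_carrier)
  note Gi = bordered_matrix_index[of _ k _ "real_of_int p * 2 ^ r" "2 ^ r * real_of_int v" "2 * x", folded G_def]
  have two_r: "(2::real) ^ r = 2 * 2 ^ (r - 1)" using r by (simp add: power_eq_if)
  have "p dvd 2 ^ (r - 1) * v\<^sup>2 + c" using v(1) by (simp add: cong_iff_dvd_diff)
  then obtain X where X: "2 ^ (r - 1) * v\<^sup>2 + c = p * X" by blast
  hence "real_of_int (2 ^ (r - 1) * v\<^sup>2 + c) = real_of_int (p * X)" by (simp only:)
  hence "2 ^ (r - 1) * (real_of_int v)\<^sup>2 + real_of_int c = real_of_int p * real_of_int X" by simp
  hence xX: "x = real_of_int X" using x p by simp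
  have px: "2 * real_of_int p * x = 2 ^ r * (real_of_int v)\<^sup>2 + 2 * real_of_int c"
    using x p by (simp add: two_r field_simps)
  \<comment> \<open>By the congruence for \<open>v\<close>, a common divisor of \<open>p\<close> and
    \<open>v\<close> divides \<open>c\<close>, which is coprime to \<open>p\<close>.\<close>
  have cop: "coprime p v"
  proof (rule coprimeI)
    fix d assume d: "d dvd p" "d dvd v"
    hence "d dvd p * X - 2 ^ (r - 1) * v\<^sup>2" by (simp add: power2_eq_square)
    hence "d dvd c" using X by (metis add_diff_cancel_left')
    thus "is_unit d" using d(1) v(2) by (metis coprime_common_divisor)
  qed
  have "realizes (Z_lattice (k + 2)) (gram_form G) (A_module r a)"
  proof (rule realizes_Z_lattice[OF Gc])
    show "G $$ (i, j) \<in> \<int>" if "i < k + 2" "j < k + 2" for i j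
      using that by (auto simp: Gi xX)
    show "G $$ (i, j) = G $$ (j, i)" if "i < k + 2" "j < k + 2" for i j
      using that by (auto simp: Gi)
    show "\<exists>l::int. G $$ (i, i) = 2 * real_of_int l" if "i < k + 2" for i
    proof -
      have "G $$ (i, i) = 2 * real_of_int (if i = 0 then p * 2 ^ (r - 1) else if i = 1 then X else 1)"
        using that by (auto simp: Gi xX two_r)
      thus ?thesis by blast
    qed
    show "G $$ (0, 0) = real_of_int p * 2 ^ r" by (simp add: Gi)
    show "G $$ (0, j) / 2 ^ r \<in> \<int>" if "j < k + 2" for j using that by (simp add: Gi)
    show "y i = 0" if le: "gram_form G y y \<le> 0" and i: "i < k + 2" for y i
    proof -
      let ?T = "2 * real_of_int c / real_of_int p * (y 1)\<^sup>2 + gram_form (bordered_matrix 0 0 0 k) y y"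
      define w where "w = 2 ^ r / real_of_int p"
      have w: "2 ^ r = w * real_of_int p" using p by (simp add: w_def)
      have "2 * x = w * (real_of_int v)\<^sup>2 + 2 * real_of_int c / real_of_int p"
        using px p by (simp add: w_def field_simps)
      hence "gram_form G y y = real_of_int p * (w * real_of_int p) * (y 0)\<^sup>2 +
          2 * (w * real_of_int p * real_of_int v) * y 0 * y 1 +
          (w * (real_of_int v)\<^sup>2 + 2 * real_of_int c / real_of_int p) * (y 1)\<^sup>2 +
          gram_form (bordered_matrix 0 0 0 k) y y"
        using gram_form_bordered_matrix[OF k, of "real_of_int p * 2 ^ r" "2 ^ r * real_of_int v" "2 * x" y]
        unfolding G_def w by simp
      moreover have "P * (w * P) * Y\<^sup>2 + 2 * (w * P * V) * Y * Z + (w * V\<^sup>2 + e) * Z\<^sup>2 + f = w * (P * Y + V * Z)\<^sup>2 + (e * Z\<^sup>2 + f)"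
        for P V Y Z e f :: real by (simp add: power2_eq_square algebra_simps)
      ultimately have form: "gram_form G y y = w * (real_of_int p * y 0 + real_of_int v * y 1)\<^sup>2 + ?T"
        by metis
      have w0: "w > 0" using p by (simp add: w_def)
      have sq: "w * (real_of_int p * y 0 + real_of_int v * y 1)\<^sup>2 \<ge> 0" using w0 by simp
      hence "?T \<le> 0" using le form by linarith
      note 0 = tail_pos[OF this]
      \<comment> \<open>Row 0 of the tail matrix is zero, so \<open>y 0\<close> may still be
        arbitrary here.\<close>
      have "gram_form (bordered_matrix 0 0 0 k) y y = (\<Sum>i<k + 2. 0)"
        unfolding gram_form_sum[OF bordered_matrix_carrier]
      proof (intro sum.cong refl)
        fix i assume i: "i \<in> {..<k + 2}"
        have "(\<Sum>j<k + 2. bordered_matrix 0 0 0 k $$ (0, j) * y j) = 0"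
          by (intro sum.neutral ballI) (simp add: bordered_matrix_index)
        thus "y i * (\<Sum>j<k + 2. bordered_matrix 0 0 0 k $$ (i, j) * y j) = 0"
          using 0[of i] i by (cases "i = 0") auto
      qed
      hence "w * (real_of_int p * y 0)\<^sup>2 \<le> 0" using le form 0[of 1] by simp
      hence "y 0 = 0" using p w0 by (simp add: mult_le_0_iff)
      thus ?thesis using 0[of i] i by (cases "i = 0") auto
    qed
    show "(if i = 0 then 2 ^ r * y 0 else y i) \<in> \<int>"
      if rows: "\<And>i. i < k + 2 \<Longrightarrow> (\<Sum>j<k + 2. G $$ (i, j) * y j) \<in> \<int>" and i: "i < k + 2" for y i
    proof -
      have 00: "(\<Sum>j<k + 2. bordered_matrix 0 0 0 k $$ (0, j) * y j) = 0"
        by (intro sum.neutral ballI) (simp add: bordered_matrix_index)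
      have "(\<Sum>j<k + 2. bordered_matrix 0 0 0 k $$ (1, j) * y j) = (\<Sum>j<k + 2. if j = 2 then y 2 else 0)"
        by (intro sum.cong refl) (auto simp: bordered_matrix_index)
      also have "\<dots> = y 2" using k by simp
      finally have 01: "(\<Sum>j<k + 2. bordered_matrix 0 0 0 k $$ (1, j) * y j) = y 2" .
      note row_sum = bordered_matrix_row_sum[OF k, of _ "real_of_int p * 2 ^ r" "2 ^ r * real_of_int v" "2 * x" y, folded G_def]
      define A where "A = real_of_int p * 2 ^ r * y 0 + 2 ^ r * real_of_int v * y 1"
      define C where "C = 2 ^ r * real_of_int v * y 0 + 2 * x * y 1 + y 2"
      have A: "A \<in> \<int>"
        using rows[of 0] row_sum[of 0] unfolding A_def 00 by simp
      have C: "C \<in> \<int>"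
        using rows[of 1] row_sum[of 1] unfolding C_def 01 by (simp add: add_ac)
      have "real_of_int p * C - real_of_int v * A = (2 * real_of_int p * x - 2 ^ r * (real_of_int v)\<^sup>2) * y 1 + real_of_int p * y 2"
        by (simp add: A_def C_def power2_eq_square algebra_simps)
      hence "2 * real_of_int c * y 1 + real_of_int p * y 2 = real_of_int p * C - real_of_int v * A"
        by (simp add: px)
      also have "\<dots> \<in> \<int>" using A C by (intro Ints_diff Ints_mult) auto
      finally have "2 * real_of_int c * y 1 + real_of_int p * y 2 \<in> \<int>" .
      moreover have "(\<Sum>j<k + 2. bordered_matrix 0 0 0 k $$ (i, j) * y j) \<in> \<int>" if "2 \<le> i" "i < k + 2" for i
        using rows[OF that(2)] row_sum[OF that(2)] that(1) by simp
      ultimately have tail: "y i \<in> \<int>" if "0 < i" "i < k + 2" for i by (rule tail_dual[OF _ _ that])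
      have y12: "y 1 \<in> \<int>" "y 2 \<in> \<int>" using k by (auto intro: tail)
      have "real_of_int p * (2 ^ r * y 0) = A - 2 ^ r * real_of_int v * y 1" by (simp add: A_def)
      also have "\<dots> \<in> \<int>" using A y12 by (intro Ints_diff Ints_mult) auto
      finally have 1: "real_of_int p * (2 ^ r * y 0) \<in> \<int>" .
      have "real_of_int v * (2 ^ r * y 0) = C - 2 * real_of_int X * y 1 - y 2" by (simp add: C_def xX)
      also have "\<dots> \<in> \<int>" using C y12 by (intro Ints_diff Ints_mult) auto
      finally have "2 ^ r * y 0 \<in> \<int>" by (rule Ints_of_coprime_multiples[OF cop 1])
      thus ?thesis using tail[of i] i by simp
    qed
  qed (use a in auto)
  thus ?thesis by (simp add: G_def)
qed

section \<open>The explicit lattices of rank 3, 5, 7 and 1\<close>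

lemma gram_form_bordered_matrix_1:
  "gram_form (bordered_matrix 0 0 0 1) y y = 2 * y 1 * y 2 + 2 * (y 2)\<^sup>2"
proof -
  have "{..<1 + 2 :: nat} = {0, 1, 2}" by auto
  thus ?thesis unfolding gram_form_sum[OF bordered_matrix_carrier]
    by (simp add: bordered_matrix_index power2_eq_square algebra_simps del: One_nat_def)
qed

text \<open>In this and the next two cases \<open>p = k + 2\<close> and
  \<open>2 * c = k + 1\<close>. Up to signs of basis vectors \<open>F_matrix k\<close> is the Gram
  matrix of the root lattice A_k, of determinant k + 1. Bordered by the corner
  \<open>2 * c / p\<close> it has determinant (k+1)^2/(k+2) - k = 1/p, so this tail is positive
  definite and the whole Gram matrix has determinant \<open>2 ^ r\<close>.\<close>

lemma realizes_bordered_matrix_1: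
  fixes v a :: int and x :: real
  assumes r: "r > 0" and v: "[2 ^ (r - 1) * v\<^sup>2 = - 1] (mod 3)"
    and x: "x = (2 ^ (r - 1) * (real_of_int v)\<^sup>2 + 1) / 3" and a: "odd a" "[a = 3] (mod 8)"
  shows "realizes (Z_lattice 3) (gram_form (bordered_matrix (3 * 2 ^ r) (2 ^ r * real_of_int v) (2 * x) 1)) (A_module r a)"
proof -
  have "realizes (Z_lattice (1 + 2))
    (gram_form (bordered_matrix (real_of_int 3 * 2 ^ r) (2 ^ r * real_of_int v) (2 * x) 1)) (A_module r a)"
  proof (rule realizes_bordered_matrix[of _ _ _ _ 1])
    show "coprime 3 (1 :: int)" by (simp add: coprime_iff_gcd_eq_1 gcd_non_0_int)
    fix y :: "nat \<Rightarrow> real" and i :: nat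
    assume i: "0 < i" "i < 1 + 2"
    have i_cases: "i = 1 \<or> i = 2" using i by auto
    {
      assume "2 * real_of_int 1 / real_of_int 3 * (y 1)\<^sup>2 + gram_form (bordered_matrix 0 0 0 1) y y \<le> 0"
      \<comment> \<open>The coefficient left for \<open>(y 1)\<^sup>2\<close> is 2/3 - 1/2.\<close>
      hence le: "2 * (y 2 + 1 / 2 * y 1)\<^sup>2 + 1 / 6 * (y 1)\<^sup>2 \<le> 0"
        by (simp add: gram_form_bordered_matrix_1 power2_eq_square algebra_simps del: One_nat_def)
      have sq: "(y 2 + 1 / 2 * y 1)\<^sup>2 \<ge> 0" "(y 1)\<^sup>2 \<ge> 0" by simp_all
      have "(y 1)\<^sup>2 = 0" using le sq by linarith
      hence y1: "y 1 = 0" by simp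
      have "(y 2 + 1 / 2 * y 1)\<^sup>2 = 0" using le sq by linarith
      hence y2: "y 2 = 0" using y1 by simp
      show "y i = 0" using i_cases y1 y2 by auto
    }
    assume Z0: "2 * real_of_int 1 * y 1 + real_of_int 3 * y 2 \<in> \<int>"
    assume rows: "\<And>i. 2 \<le> i \<Longrightarrow> i < 1 + 2 \<Longrightarrow> (\<Sum>j<1 + 2. bordered_matrix 0 0 0 1 $$ (i, j) * y j) \<in> \<int>"
    have "{..<1 + 2 :: nat} = {0, 1, 2}" by auto
    note rows = rows[unfolded this]
    have Z2: "y 1 + 2 * y 2 \<in> \<int>"
      using rows[of 2] by (simp add: bordered_matrix_index add_ac del: One_nat_def)
    obtain z0 z2 where z: "2 * y 1 + 3 * y 2 = real_of_int z0" "y 1 + 2 * y 2 = real_of_int z2"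
      using Z0 Z2 by (auto elim!: Ints_cases)
    define w2 where "w2 = (2) * z2 - z0"
    have w2: "y 2 = real_of_int w2" using z by (simp add: w2_def)
    have w1: "y 1 = real_of_int (z2 - 2 * w2)" using z w2 by simp
    show "y i \<in> \<int>" using i_cases w1 w2 by auto
  qed (use assms in \<open>auto simp: cong_sym_eq\<close>)
  thus ?thesis by (simp add: eval_nat_numeral)
qed

lemma gram_form_bordered_matrix_3:
  "gram_form (bordered_matrix 0 0 0 3) y y = 2 * y 1 * y 2 + 2 * (y 2)\<^sup>2 + 2 * (y 3)\<^sup>2 + 2 * (y 4)\<^sup>2 + 2 * y 2 * y 3 + 2 * y 3 * y 4"
proof -
  have "{..<3 + 2 :: nat} = {0, 1, 2, 3, 4}" by auto
  thus ?thesis unfolding gram_form_sum[OF bordered_matrix_carrier]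
    by (simp add: bordered_matrix_index power2_eq_square algebra_simps del: One_nat_def)
qed

lemma realizes_bordered_matrix_3:
  fixes v a :: int and x :: real
  assumes r: "r > 0" and v: "[2 ^ (r - 1) * v\<^sup>2 = - 2] (mod 5)"
    and x: "x = (2 ^ (r - 1) * (real_of_int v)\<^sup>2 + 2) / 5" and a: "odd a" "[a = 5] (mod 8)"
  shows "realizes (Z_lattice 5) (gram_form (bordered_matrix (5 * 2 ^ r) (2 ^ r * real_of_int v) (2 * x) 3)) (A_module r a)"
proof -
  have "realizes (Z_lattice (3 + 2))
    (gram_form (bordered_matrix (real_of_int 5 * 2 ^ r) (2 ^ r * real_of_int v) (2 * x) 3)) (A_module r a)"
  proof (rule realizes_bordered_matrix[of _ _ _ _ 2])
    show "coprime 5 (2 :: int)" by (simp add: coprime_iff_gcd_eq_1 gcd_non_0_int)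
    fix y :: "nat \<Rightarrow> real" and i :: nat
    assume i: "0 < i" "i < 3 + 2"
    have i_cases: "i = 1 \<or> i = 2 \<or> i = 3 \<or> i = 4" using i by auto
    {
      assume "2 * real_of_int 2 / real_of_int 5 * (y 1)\<^sup>2 + gram_form (bordered_matrix 0 0 0 3) y y \<le> 0"
      \<comment> \<open>Squares are completed from the far end of the chain: 2, 3/2, 4/3 are the
        quotients of successive determinants j + 1 of \<open>F_matrix j\<close>, and 1/20 is 4/5 -
        3/4.\<close>
      hence le: "2 * (y 4 + 1 / 2 * y 3)\<^sup>2 + 3 / 2 * (y 3 + 2 / 3 * y 2)\<^sup>2 + 4 / 3 * (y 2 + 3 / 4 * y 1)\<^sup>2 + 1 / 20 * (y 1)\<^sup>2 \<le> 0"
        by (simp add: gram_form_bordered_matrix_3 power2_eq_square algebra_simps del: One_nat_def)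
      have sq: "(y 4 + 1 / 2 * y 3)\<^sup>2 \<ge> 0" "(y 3 + 2 / 3 * y 2)\<^sup>2 \<ge> 0" "(y 2 + 3 / 4 * y 1)\<^sup>2 \<ge> 0" "(y 1)\<^sup>2 \<ge> 0" by simp_all
      have "(y 1)\<^sup>2 = 0" using le sq by linarith
      hence y1: "y 1 = 0" by simp
      have "(y 2 + 3 / 4 * y 1)\<^sup>2 = 0" using le sq by linarith
      hence y2: "y 2 = 0" using y1 by simp
      have "(y 3 + 2 / 3 * y 2)\<^sup>2 = 0" using le sq by linarith
      hence y3: "y 3 = 0" using y2 by simp
      have "(y 4 + 1 / 2 * y 3)\<^sup>2 = 0" using le sq by linarith
      hence y4: "y 4 = 0" using y3 by simp
      show "y i = 0" using i_cases y1 y2 y3 y4 by auto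
    }
    assume Z0: "2 * real_of_int 2 * y 1 + real_of_int 5 * y 2 \<in> \<int>"
    assume rows: "\<And>i. 2 \<le> i \<Longrightarrow> i < 3 + 2 \<Longrightarrow> (\<Sum>j<3 + 2. bordered_matrix 0 0 0 3 $$ (i, j) * y j) \<in> \<int>"
    have "{..<3 + 2 :: nat} = {0, 1, 2, 3, 4}" by auto
    note rows = rows[unfolded this]
    have Z2: "y 1 + 2 * y 2 + y 3 \<in> \<int>"
      using rows[of 2] by (simp add: bordered_matrix_index add_ac del: One_nat_def)
    have Z3: "y 2 + 2 * y 3 + y 4 \<in> \<int>"
      using rows[of 3] by (simp add: bordered_matrix_index add_ac del: One_nat_def)
    have Z4: "y 3 + 2 * y 4 \<in> \<int>"
      using rows[of 4] by (simp add: bordered_matrix_index add_ac del: One_nat_def)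
    obtain z0 z2 z3 z4 where z: "4 * y 1 + 5 * y 2 = real_of_int z0" "y 1 + 2 * y 2 + y 3 = real_of_int z2" "y 2 + 2 * y 3 + y 4 = real_of_int z3" "y 3 + 2 * y 4 = real_of_int z4"
      using Z0 Z2 Z3 Z4 by (auto elim!: Ints_cases)
    \<comment> \<open>The alternating weights 4, -3, 2 cancel \<open>y 3\<close>, and subtracting
      \<open>z0\<close> cancels \<open>y 1\<close> and \<open>y 2\<close> because
      \<open>2 * c = 4\<close> and \<open>p = 5\<close>. Only \<open>y 4\<close> is left, with
      coefficient 4 - 3 = 1; the other coordinates follow by back substitution.\<close>
    define w4 where "w4 = (4) * z2 + (-3) * z3 + (2) * z4 - z0"
    have w4: "y 4 = real_of_int w4" using z by (simp add: w4_def)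
    define w3 where "w3 = z4 - 2 * w4"
    have w3: "y 3 = real_of_int w3" using z w4 by (simp add: w3_def)
    define w2 where "w2 = z3 - 2 * w3 - w4"
    have w2: "y 2 = real_of_int w2" using z w3 w4 by (simp add: w2_def)
    have w1: "y 1 = real_of_int (z2 - 2 * w2 - w3)" using z w2 w3 by simp
    show "y i \<in> \<int>" using i_cases w1 w2 w3 w4 by auto
  qed (use assms in \<open>auto simp: cong_sym_eq\<close>)
  thus ?thesis by (simp add: eval_nat_numeral)
qed

lemma gram_form_bordered_matrix_5:
  "gram_form (bordered_matrix 0 0 0 5) y y = 2 * y 1 * y 2 + 2 * (y 2)\<^sup>2 + 2 * (y 3)\<^sup>2 + 2 * (y 4)\<^sup>2 + 2 * (y 5)\<^sup>2 + 2 * (y 6)\<^sup>2 + 2 * y 2 * y 3 + 2 * y 3 * y 4 + 2 * y 4 * y 5 + 2 * y 5 * y 6"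
proof -
  have "{..<5 + 2 :: nat} = {0, 1, 2, 3, 4, 5, 6}" by auto
  thus ?thesis unfolding gram_form_sum[OF bordered_matrix_carrier]
    by (simp add: bordered_matrix_index power2_eq_square algebra_simps del: One_nat_def)
qed

lemma realizes_bordered_matrix_5:
  fixes v a :: int and x :: real
  assumes r: "r > 0" and v: "[2 ^ (r - 1) * v\<^sup>2 = - 3] (mod 7)"
    and x: "x = (2 ^ (r - 1) * (real_of_int v)\<^sup>2 + 3) / 7" and a: "odd a" "[a = 7] (mod 8)"
  shows "realizes (Z_lattice 7) (gram_form (bordered_matrix (7 * 2 ^ r) (2 ^ r * real_of_int v) (2 * x) 5)) (A_module r a)"
proof -
  have "realizes (Z_lattice (5 + 2))
    (gram_form (bordered_matrix (real_of_int 7 * 2 ^ r) (2 ^ r * real_of_int v) (2 * x) 5)) (A_module r a)"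
  proof (rule realizes_bordered_matrix[of _ _ _ _ 3])
    show "coprime 7 (3 :: int)" by (simp add: coprime_iff_gcd_eq_1 gcd_non_0_int)
    fix y :: "nat \<Rightarrow> real" and i :: nat
    assume i: "0 < i" "i < 5 + 2"
    have i_cases: "i = 1 \<or> i = 2 \<or> i = 3 \<or> i = 4 \<or> i = 5 \<or> i = 6" using i by auto
    {
      assume "2 * real_of_int 3 / real_of_int 7 * (y 1)\<^sup>2 + gram_form (bordered_matrix 0 0 0 5) y y \<le> 0"
      \<comment> \<open>The same pattern on a longer chain, with remainder 6/7 - 5/6.\<close>
      hence le: "2 * (y 6 + 1 / 2 * y 5)\<^sup>2 + 3 / 2 * (y 5 + 2 / 3 * y 4)\<^sup>2 + 4 / 3 * (y 4 + 3 / 4 * y 3)\<^sup>2 + 5 / 4 * (y 3 + 4 / 5 * y 2)\<^sup>2 + 6 / 5 * (y 2 + 5 / 6 * y 1)\<^sup>2 + 1 / 42 * (y 1)\<^sup>2 \<le> 0"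
        by (simp add: gram_form_bordered_matrix_5 power2_eq_square algebra_simps del: One_nat_def)
      have sq: "(y 6 + 1 / 2 * y 5)\<^sup>2 \<ge> 0" "(y 5 + 2 / 3 * y 4)\<^sup>2 \<ge> 0" "(y 4 + 3 / 4 * y 3)\<^sup>2 \<ge> 0" "(y 3 + 4 / 5 * y 2)\<^sup>2 \<ge> 0" "(y 2 + 5 / 6 * y 1)\<^sup>2 \<ge> 0" "(y 1)\<^sup>2 \<ge> 0" by simp_all
      have "(y 1)\<^sup>2 = 0" using le sq by linarith
      hence y1: "y 1 = 0" by simp
      have "(y 2 + 5 / 6 * y 1)\<^sup>2 = 0" using le sq by linarith
      hence y2: "y 2 = 0" using y1 by simp
      have "(y 3 + 4 / 5 * y 2)\<^sup>2 = 0" using le sq by linarith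
      hence y3: "y 3 = 0" using y2 by simp
      have "(y 4 + 3 / 4 * y 3)\<^sup>2 = 0" using le sq by linarith
      hence y4: "y 4 = 0" using y3 by simp
      have "(y 5 + 2 / 3 * y 4)\<^sup>2 = 0" using le sq by linarith
      hence y5: "y 5 = 0" using y4 by simp
      have "(y 6 + 1 / 2 * y 5)\<^sup>2 = 0" using le sq by linarith
      hence y6: "y 6 = 0" using y5 by simp
      show "y i = 0" using i_cases y1 y2 y3 y4 y5 y6 by auto
    }
    assume Z0: "2 * real_of_int 3 * y 1 + real_of_int 7 * y 2 \<in> \<int>"
    assume rows: "\<And>i. 2 \<le> i \<Longrightarrow> i < 5 + 2 \<Longrightarrow> (\<Sum>j<5 + 2. bordered_matrix 0 0 0 5 $$ (i, j) * y j) \<in> \<int>"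
    have "{..<5 + 2 :: nat} = {0, 1, 2, 3, 4, 5, 6}" by auto
    note rows = rows[unfolded this]
    have Z2: "y 1 + 2 * y 2 + y 3 \<in> \<int>"
      using rows[of 2] by (simp add: bordered_matrix_index add_ac del: One_nat_def)
    have Z3: "y 2 + 2 * y 3 + y 4 \<in> \<int>"
      using rows[of 3] by (simp add: bordered_matrix_index add_ac del: One_nat_def)
    have Z4: "y 3 + 2 * y 4 + y 5 \<in> \<int>"
      using rows[of 4] by (simp add: bordered_matrix_index add_ac del: One_nat_def)
    have Z5: "y 4 + 2 * y 5 + y 6 \<in> \<int>"
      using rows[of 5] by (simp add: bordered_matrix_index add_ac del: One_nat_def)
    have Z6: "y 5 + 2 * y 6 \<in> \<int>"
      using rows[of 6] by (simp add: bordered_matrix_index add_ac del: One_nat_def)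
    obtain z0 z2 z3 z4 z5 z6 where z: "6 * y 1 + 7 * y 2 = real_of_int z0" "y 1 + 2 * y 2 + y 3 = real_of_int z2" "y 2 + 2 * y 3 + y 4 = real_of_int z3" "y 3 + 2 * y 4 + y 5 = real_of_int z4" "y 4 + 2 * y 5 + y 6 = real_of_int z5" "y 5 + 2 * y 6 = real_of_int z6"
      using Z0 Z2 Z3 Z4 Z5 Z6 by (auto elim!: Ints_cases)
    \<comment> \<open>Alternating weights from 6 down to 2 isolate the last coordinate, as
      \<open>2 * c = 6\<close> and \<open>p = 7\<close>.\<close>
    define w6 where "w6 = (6) * z2 + (-5) * z3 + (4) * z4 + (-3) * z5 + (2) * z6 - z0"
    have w6: "y 6 = real_of_int w6" using z by (simp add: w6_def)
    define w5 where "w5 = z6 - 2 * w6"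
    have w5: "y 5 = real_of_int w5" using z w6 by (simp add: w5_def)
    define w4 where "w4 = z5 - 2 * w5 - w6"
    have w4: "y 4 = real_of_int w4" using z w5 w6 by (simp add: w4_def)
    define w3 where "w3 = z4 - 2 * w4 - w5"
    have w3: "y 3 = real_of_int w3" using z w4 w5 by (simp add: w3_def)
    define w2 where "w2 = z3 - 2 * w3 - w4"
    have w2: "y 2 = real_of_int w2" using z w3 w4 by (simp add: w2_def)
    have w1: "y 1 = real_of_int (z2 - 2 * w2 - w3)" using z w2 w3 by simp
    show "y i \<in> \<int>" using i_cases w1 w2 w3 w4 w5 w6 by auto
  qed (use assms in \<open>auto simp: cong_sym_eq\<close>)
  thus ?thesis by (simp add: eval_nat_numeral)
qed

lemma realizes_Z_lattice_1:
  assumes r: "r > 0" and a: "odd a" "[a = 1] (mod 8)"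
  shows "realizes (Z_lattice 1) (gram_form (mat_of_rows_list 1 [[2 ^ r]])) (A_module r a)"
proof -
  define G :: "real mat" where "G = mat_of_rows_list 1 [[2 ^ r]]"
  have G: "G \<in> carrier_mat 1 1" and G00: "G $$ (0, 0) = 2 ^ r" by (auto simp: G_def mat_of_rows_list_def)
  have "realizes (Z_lattice 1) (gram_form G) (A_module r a)"
  proof (rule realizes_Z_lattice[OF G, where b = 1])
    show "\<exists>k::int. G $$ (i, i) = 2 * real_of_int k" if "i < 1" for i
    proof -
      have "(2::real) ^ r = 2 * real_of_int (2 ^ (r - 1))" using r by (cases r) auto
      thus ?thesis using that G00 by (intro exI[of _ "2 ^ (r - 1)"]) simp
    qed
    show "x i = 0" if "gram_form G x x \<le> 0" "i < 1" for x i
    proof -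
      have "gram_form G x x = 2 ^ r * (x 0)\<^sup>2"
        by (simp add: gram_form_sum[OF G] G00 power2_eq_square)
      hence "2 ^ r * (x 0)\<^sup>2 \<le> 2 ^ r * 0" using that by simp
      hence "(x 0)\<^sup>2 \<le> 0" by (subst (asm) mult_le_cancel_left_pos) auto
      thus ?thesis using that by simp
    qed
    show "(if i = 0 then 2 ^ r * y 0 else y i) \<in> \<int>"
      if "\<And>i. i < 1 \<Longrightarrow> (\<Sum>j<1. G $$ (i, j) * y j) \<in> \<int>" "i < 1" for y i
      using that(1)[of 0] that(2) by (simp add: G00)
  qed (use a G00 in \<open>auto simp: cong_sym_eq\<close>)
  thus ?thesis by (simp add: G_def)
qed

section \<open>Minimality of the rank\<close>

text \<open>An odd rank below \<open>m \<le> 7\<close> is at most 5, where the congruence modulo 8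
  is available; but numbers below 8 that are congruent modulo 8 are equal.\<close>

lemma residue_mod_8_le_rank:
  fixes L :: "'v::real_vector set"
  assumes R: "realizes L B (A_module r a)" and r: "even r" "r > 0" and a: "odd a"
    and m: "[a = int m] (mod 8)" "m < 8"
  shows "m \<le> lattice_rank L"
proof (rule ccontr)
  assume less: "\<not> m \<le> lattice_rank L"
  have "even a = even (int m)" using m(1) by (metis cong_dvd_iff cong_dvd_modulus even_numeral)
  hence "odd m" using a by simp
  hence "lattice_rank L \<le> 5"
    using rank_of_realization(1)[OF R r a] less m(2) by presburger
  hence "[int m = int (lattice_rank L)] (mod 8)"
    using rank_of_realization(2)[OF R r a] m(1) by (metis cong_sym cong_trans)
  hence "int m mod 8 = int (lattice_rank L) mod 8" by (simp add: cong_def)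
  thus False using less m(2) by simp
qed

theorem theorem5p8:
  fixes r :: nat and a :: int
  assumes "even r" and "r > 0" and "odd a"
  shows
    "([a = 1] (mod 8) \<longrightarrow>
        realizes (Z_lattice 1) (gram_form (mat_of_rows_list 1 [[2 ^ r]])) (A_module r a) \<and>
        (\<forall>(L :: 'v::real_vector set) B. realizes L B (A_module r a) \<longrightarrow>
           lattice_rank (Z_lattice 1) \<le> lattice_rank L)) \<and>
     ([a = 3] (mod 8) \<longrightarrow>
        (\<forall>(v :: int) (x :: real).
           [2 ^ (r - 1) * v\<^sup>2 = - 1] (mod 3) \<longrightarrow>
           x = (2 ^ (r - 1) * (real_of_int v)\<^sup>2 + 1) / 3 \<longrightarrow>
           realizes (Z_lattice 3)
             (gram_form (mat_of_rows_list 3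
                [[3 * 2 ^ r, 2 ^ r * real_of_int v, 0],
                 [2 ^ r * real_of_int v, 2 * x, 1],
                 [0, 1, 2]]))
             (A_module r a) \<and>
           (\<forall>(L :: 'v set) B. realizes L B (A_module r a) \<longrightarrow>
              lattice_rank (Z_lattice 3) \<le> lattice_rank L))) \<and>
     ([a = 5] (mod 8) \<longrightarrow>
        (\<forall>(v :: int) (x :: real).
           [2 ^ (r - 1) * v\<^sup>2 = - 2] (mod 5) \<longrightarrow>
           x = (2 ^ (r - 1) * (real_of_int v)\<^sup>2 + 2) / 5 \<longrightarrow>
           realizes (Z_lattice 5)
             (gram_form (bordered_matrix (5 * 2 ^ r) (2 ^ r * real_of_int v) (2 * x) 3))
             (A_module r a) \<and>
           (\<forall>(L :: 'v set) B. realizes L B (A_module r a) \<longrightarrow>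
              lattice_rank (Z_lattice 5) \<le> lattice_rank L))) \<and>
     ([a = 7] (mod 8) \<longrightarrow>
        (\<forall>(v :: int) (x :: real).
           [2 ^ (r - 1) * v\<^sup>2 = - 3] (mod 7) \<longrightarrow>
           x = (2 ^ (r - 1) * (real_of_int v)\<^sup>2 + 3) / 7 \<longrightarrow>
           realizes (Z_lattice 7)
             (gram_form (bordered_matrix (7 * 2 ^ r) (2 ^ r * real_of_int v) (2 * x) 5))
             (A_module r a) \<and>
           (\<forall>(L :: 'v set) B. realizes L B (A_module r a) \<longrightarrow>
              lattice_rank (Z_lattice 7) \<le> lattice_rank L)))"
proof -
  have rank: "lattice_rank (Z_lattice m) \<le> lattice_rank L"
    if "realizes L B (A_module r a)" "[a = int m] (mod 8)" "m < 8" for m and L :: "'v set" and B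
    using residue_mod_8_le_rank[OF that(1) assms that(2,3)] by (simp add: lattice_rank_Z_lattice)
  show ?thesis
    unfolding mat_3_eq_bordered_matrix
    by (intro conjI impI allI realizes_Z_lattice_1 realizes_bordered_matrix_1 realizes_bordered_matrix_3
        realizes_bordered_matrix_5; (rule rank)?) (use assms in simp_all)
qed

end
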